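(* There is an absolute constant $C>0$ such that the following holds. Let $n\ge k\ge 1$ and let $\mu:\binom{[n]}{k}\to\mathbb{R}_{\geq 0}$ be a function, not identically zero, whose generating polynomial $g_\mu$ is log-concave. Let $P$ be the down-up random walk with respect to $\mu$. Then for every starting set $S_0\in\binom{[n]}{k}$ with $\mu(S_0)>0$ and every $\epsilon\in(0,1)$, \[ t_{\mathrm{mix}}(P,S_0,\epsilon)\le C\, k\log(k/\epsilon). \]
   Context: $[n]=\{1,\dots,n\}$ and $\binom{[n]}{k}$ is the family of $k$-element subsets of $[n]$. The function $\mu$ defines the probability distribution $\Pr[S]\propto\mu(S)$ on $\binom{[n]}{k}$ (also denoted $\mu$). Its generating polynomial is $g_\mu(z_1,\dots,z_n)=\sum_{S\in\binom{[n]}{k}}\mu(S)\prod_{i\in S}z_i$; it is called log-concave if $g_\mu(\lambda x+(1-\lambda)y)\ge g_\mu(x)^\lambda g_\mu(y)^{1-\lambda}$ for all $x,y\in\mathbb{R}_{\ge0}^n$ and $\lambda\in(0,1)$ (i.e. $\log g_\mu$ is concave on the nonnegative orthant). The down-up random walk $P$ moves from $S\in\binom{[n]}{k}$ to $S'\in\binom{[n]}{k}$ as follows: choose a $(k-1)$-subset $T\subseteq S$ uniformly at random, then choose $S'\supseteq T$, $S'\in\binom{[n]}{k}$, with probability proportional to $\mu(S')$. The mixing time is $t_{\mathrm{mix}}(P,S_0,\epsilon)=\min\{t: \|P^t(S_0,\cdot)-\mu(\cdot)\|_{\mathrm{TV}}\le\epsilon\}$, where $\|\nu-\mu\|_{\mathrm{TV}}=\frac12\sum_S|\nu(S)-\mu(S)|$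 and $\mu$ is normalized to a probability distribution.
   Formalization: For k=1 the bound is rounded up to ⌈C k log(k/ε)⌉, because the literal inequality fails there: for uniform μ on the singletons of [n], n large and ε near 1, one step is needed while C log(1/ε)<1. For k≥2 the bound is as stated. *)

theory Defs
  imports "HOL-Analysis.Analysis" "HOL-Library.Extended_Nat" "HOL-Library.Extended_Real"
begin

definition ksubsets :: "nat \<Rightarrow> nat \<Rightarrow> nat set set" where
  "ksubsets n k = {S. S \<subseteq> {1..n} \<and> card S = k}"

text \<open>A weight function is a total function on sets of naturals; only its values on
  \<^term>\<open>ksubsets n k\<close> are ever used. Likewise a vector indexed by \<^term>\<open>{1..n}\<close> is a function
  of type \<^typ>\<open>nat \<Rightarrow> real\<close> of which only the coordinates in \<^term>\<open>{1..n}\<close> matter.\<close>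

definition gen_poly :: "nat \<Rightarrow> nat \<Rightarrow> (nat set \<Rightarrow> real) \<Rightarrow> (nat \<Rightarrow> real) \<Rightarrow> real" where
  "gen_poly n k \<mu> z = (\<Sum>S\<in>ksubsets n k. \<mu> S * (\<Prod>i\<in>S. z i))"

text \<open>The multiplicative form of concavity of the logarithm also covers zeros of \<open>g\<close>,
  since \<open>0 powr c = 0\<close>.\<close>

definition log_concave :: "nat \<Rightarrow> ((nat \<Rightarrow> real) \<Rightarrow> real) \<Rightarrow> bool" where
  "log_concave n g \<longleftrightarrow>
     (\<forall>x y. \<forall>c\<in>{0<..<1}. (\<forall>i\<in>{1..n}. 0 \<le> x i) \<longrightarrow> (\<forall>i\<in>{1..n}. 0 \<le> y i) \<longrightarrow>
        g (\<lambda>i. c * x i + (1 - c) * y i) \<ge> g x powr c * g y powr (1 - c))"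

definition normalized :: "nat \<Rightarrow> nat \<Rightarrow> (nat set \<Rightarrow> real) \<Rightarrow> nat set \<Rightarrow> real" where
  "normalized n k \<mu> S = \<mu> S / (\<Sum>R\<in>ksubsets n k. \<mu> R)"

definition down_step :: "nat \<Rightarrow> nat set \<Rightarrow> nat set \<Rightarrow> real" where
  "down_step k S T =
     (if T \<subseteq> S \<and> card T = k - 1 then 1 / real (card {T'. T' \<subseteq> S \<and> card T' = k - 1}) else 0)"

text \<open>If all supersets of \<open>T\<close> have weight zero, the quotient is \<open>0 / 0 = 0\<close>. Such \<open>T\<close> cannot
  be reached from a set of positive weight.\<close>

definition up_step :: "nat \<Rightarrow> nat \<Rightarrow> (nat set \<Rightarrow> real) \<Rightarrow> nat set \<Rightarrow> nat set \<Rightarrow> real" where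
  "up_step n k \<mu> T S' =
     (if T \<subseteq> S' \<and> S' \<in> ksubsets n k then \<mu> S' / (\<Sum>R\<in>{R\<in>ksubsets n k. T \<subseteq> R}. \<mu> R) else 0)"

definition down_up_walk :: "nat \<Rightarrow> nat \<Rightarrow> (nat set \<Rightarrow> real) \<Rightarrow> nat set \<Rightarrow> nat set \<Rightarrow> real" where
  "down_up_walk n k \<mu> S S' = (\<Sum>T\<in>ksubsets n (k - 1). down_step k S T * up_step n k \<mu> T S')"

fun kernel_power :: "'a set \<Rightarrow> ('a \<Rightarrow> 'a \<Rightarrow> real) \<Rightarrow> nat \<Rightarrow> 'a \<Rightarrow> 'a \<Rightarrow> real" where
  "kernel_power \<Omega> P 0 x y = (if x = y then 1 else 0)"
| "kernel_power \<Omega> P (Suc t) x y = (\<Sum>z\<in>\<Omega>. kernel_power \<Omega> P t x z * P z y)"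

definition tv_dist :: "'a set \<Rightarrow> ('a \<Rightarrow> real) \<Rightarrow> ('a \<Rightarrow> real) \<Rightarrow> real" where
  "tv_dist \<Omega> \<nu> \<pi> = (\<Sum>x\<in>\<Omega>. \<bar>\<nu> x - \<pi> x\<bar>) / 2"

text \<open>The minimum is taken in the extended naturals: it is infinite if the walk never gets
  within distance \<open>\<epsilon>\<close> of \<open>\<pi>\<close>.\<close>

definition mixing_time ::
    "'a set \<Rightarrow> ('a \<Rightarrow> 'a \<Rightarrow> real) \<Rightarrow> ('a \<Rightarrow> real) \<Rightarrow> 'a \<Rightarrow> real \<Rightarrow> enat" where
  "mixing_time \<Omega> P \<pi> x \<epsilon> = (INF t\<in>{t. tv_dist \<Omega> (kernel_power \<Omega> P t x) \<pi> \<le> \<epsilon>}. enat t)"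

text \<open>About the bound \<open>C * k * ln (k / \<epsilon>)\<close>: for \<open>k = 1\<close> it tends to \<open>0\<close> as \<open>\<epsilon>\<close> tends to \<open>1\<close>, while
  the walk needs one step whenever \<open>\<epsilon>\<close> is less than one minus the stationary probability of the
  starting set. That probability can be arbitrarily small, so no absolute constant works for
  the literal inequality. Hence for \<open>k = 1\<close>, and only then, the bound on the integer number of
  steps is rounded up; for \<open>k \<ge> 2\<close> it is taken as it stands.\<close>

end

theory Submission
  imports Defs
begin

text \<open>
  A generating polynomial \<open>g\<close> is affine in every variable, so log-concavity passes to its partial
  derivatives, the generating polynomials of the links. Two consequences are combined.

  Entropy: the tangent of \<open>log g\<close> at the all-ones vector gives, by Gibbs' inequality, that the
  relative entropy of the one-element marginals is at most \<open>1 / k\<close> of the relative entropy of the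
  whole distributions. The chain rule for relative entropy propagates this through the links, so
  a down-step, and hence the walk, contracts relative entropy by \<open>1 - 1 / k\<close>.

  Warm start: log-concavity in two variables gives
  \<open>g \<partial>\<^sub>i\<partial>\<^sub>jg \<le> 2 \<partial>\<^sub>ig \<partial>\<^sub>jg\<close>. Iterated over links, it bounds the probability that
  the up-step from any \<open>T\<close> adds \<open>x\<close> by \<open>2\<^sup>k\<close> times the stationary probability of \<open>x\<close> given the
  elements of \<open>T\<close> added since the start. So once all elements of the starting set were dropped,
  which takes \<open>O(k log(k / \<epsilon>))\<close> steps with probability \<open>1 - \<epsilon> / 2\<close>, the density after \<open>t\<close> steps is
  at most \<open>exp(O(k t))\<close>, however small the weight of the starting set. Its entropy is polynomial
  in \<open>k / \<epsilon>\<close>, and contraction takes \<open>O(k log(k / \<epsilon>))\<close> further steps.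
\<close>

section \<open>Subsets of a fixed size\<close>

lemma finite_ksubsets [simp]: "finite (ksubsets n k)"
  unfolding ksubsets_def by (rule finite_subset[of _ "Pow {1..n}"]) auto

lemma ksubsetsD:
  assumes "S \<in> ksubsets n k"
  shows "S \<subseteq> {1..n}" "finite S" "card S = k"
  using assms finite_subset[of S "{1..n}"] by (auto simp: ksubsets_def)

lemma ksubsets_mem: "S \<in> ksubsets n k \<Longrightarrow> i \<in> S \<Longrightarrow> i \<in> {1..n}"
  by (auto simp: ksubsets_def)

lemma ksubsets_0 [simp]: "ksubsets n 0 = {{}}"
  by (auto simp: ksubsets_def dest: finite_subset)

lemma insert_in_ksubsets:
  assumes "T \<in> ksubsets n k" "i \<in> {1..n}" "i \<notin> T"
  shows "insert i T \<in> ksubsets n (Suc k)"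
  using assms ksubsetsD[OF assms(1)] by (auto simp: ksubsets_def)

lemma remove_in_ksubsets:
  assumes "S \<in> ksubsets n (Suc k)" "i \<in> S"
  shows "S - {i} \<in> ksubsets n k"
  using assms ksubsetsD[OF assms(1)] by (auto simp: ksubsets_def)

text \<open>Double counting: a set with a marked element is the same as a facet together with the
  element added to it.\<close>

lemma sum_ksubsets_Suc:
  "(\<Sum>S\<in>ksubsets n (Suc k). \<Sum>e\<in>S. F S e) =
   (\<Sum>T\<in>ksubsets n k. \<Sum>e\<in>{1..n} - T. F (insert e T) e)"
proof -
  have "(\<Sum>S\<in>ksubsets n (Suc k). \<Sum>e\<in>S. F S e) =
        (\<Sum>(S, e)\<in>Sigma (ksubsets n (Suc k)) (\<lambda>S. S). F S e)"
    by (rule sum.Sigma) (auto dest: ksubsetsD)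
  also have "\<dots> = (\<Sum>(T, e)\<in>Sigma (ksubsets n k) (\<lambda>T. {1..n} - T). F (insert e T) e)"
    by (rule sum.reindex_bij_witness
          [of _ "\<lambda>(T, e). (insert e T, e)" "\<lambda>(S, e). (S - {e}, e)"])
       (auto simp: insert_absorb intro!: insert_in_ksubsets remove_in_ksubsets
             dest: ksubsets_mem)
  also have "\<dots> = (\<Sum>T\<in>ksubsets n k. \<Sum>e\<in>{1..n} - T. F (insert e T) e)"
    by (rule sum.Sigma [symmetric]) auto
  finally show ?thesis .
qed

lemma sum_ksubsets_containing:
  assumes "i \<in> {1..n}"
  shows "(\<Sum>S\<in>{S \<in> ksubsets n (Suc k). i \<in> S}. F S) =
         (\<Sum>T\<in>{T \<in> ksubsets n k. i \<notin> T}. F (insert i T))"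
  by (rule sum.reindex_bij_witness[of _ "insert i" "\<lambda>S. S - {i}"])
     (use assms in \<open>auto intro: insert_in_ksubsets remove_in_ksubsets simp: insert_absorb\<close>)

subsection \<open>Links\<close>

text \<open>For finite \<open>T\<close>, the partial derivative of \<open>gen_poly n k \<nu>\<close>
  in the variables of \<open>T\<close> at the all-ones vector. For \<open>T\<close> of size
  \<open>j\<close> it is, up to normalisation, the probability of \<open>T\<close> as a uniform
  \<open>j\<close>-subset of a \<open>\<nu>\<close>-random set.\<close>

definition upmass :: "nat \<Rightarrow> nat \<Rightarrow> (nat set \<Rightarrow> real) \<Rightarrow> nat set \<Rightarrow> real" where
  "upmass n k \<nu> T = (\<Sum>S\<in>{S \<in> ksubsets n k. T \<subseteq> S}. \<nu> S)"

text \<open>For \<open>i\<close> in \<open>{1..n}\<close>, these are the weights of the partial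
  derivative in variable \<open>i\<close>. The value 0 on sets containing \<open>i\<close> keeps the
  ground set \<open>{1..n}\<close>, so links need no relabelling.\<close>

definition link :: "nat \<Rightarrow> (nat set \<Rightarrow> real) \<Rightarrow> nat set \<Rightarrow> real" where
  "link i \<nu> T = (if i \<in> T then 0 else \<nu> (insert i T))"

lemma upmass_eq_sum_if:
  "upmass n k \<nu> T = (\<Sum>S\<in>ksubsets n k. if T \<subseteq> S then \<nu> S else 0)"
  by (simp add: upmass_def sum.inter_filter)

lemma upmass_empty: "upmass n k \<nu> {} = (\<Sum>S\<in>ksubsets n k. \<nu> S)"
  by (simp add: upmass_def)

lemma upmass_ksubset:
  assumes "S \<in> ksubsets n k"
  shows "upmass n k \<nu> S = \<nu> S"
proof -
  have "S = R" if "R \<in> ksubsets n k" "S \<subseteq> R" for R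
    using card_subset_eq[OF ksubsetsD(2)[OF that(1)] that(2)] ksubsetsD(3)[OF that(1)]
      ksubsetsD(3)[OF assms] by simp
  with assms have "{R \<in> ksubsets n k. S \<subseteq> R} = {S}" by auto
  then show ?thesis by (simp add: upmass_def)
qed

lemma upmass_nonneg:
  assumes "\<And>S. S \<in> ksubsets n k \<Longrightarrow> 0 \<le> \<nu> S"
  shows "0 \<le> upmass n k \<nu> T"
  using assms by (auto simp: upmass_def intro!: sum_nonneg)

lemma upmass_antimono:
  assumes "\<And>S. S \<in> ksubsets n k \<Longrightarrow> 0 \<le> \<nu> S" "T \<subseteq> T'"
  shows "upmass n k \<nu> T' \<le> upmass n k \<nu> T"
  unfolding upmass_def using assms by (intro sum_mono2) auto

text \<open>Each set \<open>S\<close> above \<open>A\<close> is counted once for every element of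
  \<open>S\<close>, including those in \<open>A\<close>. With \<open>A = {}\<close> and constant
  \<open>w\<close> this is Euler's identity for homogeneous polynomials.\<close>

lemma sum_upmass_insert:
  "(\<Sum>e\<in>{1..n}. upmass n k \<nu> (insert e A) * w e) =
   (\<Sum>S\<in>{S \<in> ksubsets n k. A \<subseteq> S}. \<nu> S * (\<Sum>e\<in>S. w e))"
proof -
  have "(\<Sum>e\<in>{1..n}. upmass n k \<nu> (insert e A) * w e) =
        (\<Sum>e\<in>{1..n}. \<Sum>S\<in>{S \<in> ksubsets n k. A \<subseteq> S}. if e \<in> S then \<nu> S * w e else 0)"
    by (auto simp: upmass_def sum_distrib_right sum.inter_filter [symmetric] intro!: sum.cong)
  also have "\<dots> = (\<Sum>S\<in>{S \<in> ksubsets n k. A \<subseteq> S}. \<Sum>e\<in>{1..n}. if e \<in> S then \<nu> S * w e else 0)"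
    by (rule sum.swap)
  also have "\<dots> = (\<Sum>S\<in>{S \<in> ksubsets n k. A \<subseteq> S}. \<nu> S * (\<Sum>e\<in>S. w e))"
  proof (intro sum.cong refl)
    fix S assume "S \<in> {S \<in> ksubsets n k. A \<subseteq> S}"
    then have "{e \<in> {1..n}. e \<in> S} = S" by (auto dest: ksubsets_mem)
    then show "(\<Sum>e\<in>{1..n}. if e \<in> S then \<nu> S * w e else 0) = \<nu> S * (\<Sum>e\<in>S. w e)"
      by (simp add: sum.inter_filter [symmetric] sum_distrib_left)
  qed
  finally show ?thesis .
qed

text \<open>Removing \<open>i\<close> matches the sets above \<open>insert i T\<close> with the sets
  of the link above \<open>T\<close>.\<close>

lemma upmass_link:
  assumes "i \<in> {1..n}" "i \<notin> T"
  shows "upmass n k (link i \<nu>) T = upmass n (Suc k) \<nu> (insert i T)"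
proof -
  have "upmass n (Suc k) \<nu> (insert i T) =
        (\<Sum>S\<in>{S \<in> ksubsets n (Suc k). i \<in> S}. if T \<subseteq> S then \<nu> S else 0)"
    by (auto simp: upmass_def sum.inter_filter [symmetric] intro!: sum.cong)
  also have "\<dots> = (\<Sum>S\<in>{S \<in> ksubsets n k. i \<notin> S}. if T \<subseteq> insert i S then \<nu> (insert i S) else 0)"
    by (rule sum_ksubsets_containing) fact
  also have "\<dots> = upmass n k (link i \<nu>) T"
    unfolding upmass_eq_sum_if sum.inter_filter [OF finite_ksubsets]
    using assms(2) by (intro sum.cong) (auto simp: link_def)
  finally show ?thesis ..
qed

lemma upmass_link_mem: "i \<in> T \<Longrightarrow> upmass n k (link i \<nu>) T = 0"
  by (auto simp: upmass_def link_def intro!: sum.neutral)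

lemma link_nonneg:
  assumes "\<And>S. S \<in> ksubsets n (Suc k) \<Longrightarrow> 0 \<le> \<nu> S" "i \<in> {1..n}" "S \<in> ksubsets n k"
  shows "0 \<le> link i \<nu> S"
  using assms by (auto simp: link_def intro!: assms(1) insert_in_ksubsets)

section \<open>Generating polynomials and log-concavity of links\<close>

lemma gen_poly_nonneg:
  assumes "\<And>S. S \<in> ksubsets n k \<Longrightarrow> 0 \<le> \<nu> S" "\<And>i. i \<in> {1..n} \<Longrightarrow> 0 \<le> z i"
  shows "0 \<le> gen_poly n k \<nu> z"
  unfolding gen_poly_def using assms
  by (intro sum_nonneg mult_nonneg_nonneg prod_nonneg) (auto dest: ksubsets_mem)

text \<open>Splitting by membership of \<open>i\<close> shows that the polynomial is affine in
  \<open>z i\<close>: the slope belongs to the link, and the intercept does not involve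
  \<open>z i\<close>.\<close>

lemma gen_poly_Suc_upd:
  assumes "i \<in> {1..n}"
  shows "gen_poly n (Suc k) \<mu> (z(i := c)) = c * gen_poly n k (link i \<mu>) z +
           (\<Sum>S\<in>{S \<in> ksubsets n (Suc k). i \<notin> S}. \<mu> S * (\<Prod>j\<in>S. z j))"
proof -
  let ?f = "\<lambda>S. \<mu> S * (\<Prod>j\<in>S. (z(i := c)) j)"
  have "gen_poly n (Suc k) \<mu> (z(i := c)) =
        (\<Sum>S\<in>{S \<in> ksubsets n (Suc k). i \<in> S}. ?f S) +
        (\<Sum>S\<in>{S \<in> ksubsets n (Suc k). i \<notin> S}. ?f S)"
    unfolding gen_poly_def
    by (subst sum.union_disjoint [symmetric]) (auto intro!: sum.cong)
  also have "(\<Sum>S\<in>{S \<in> ksubsets n (Suc k). i \<notin> S}. ?f S) =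
        (\<Sum>S\<in>{S \<in> ksubsets n (Suc k). i \<notin> S}. \<mu> S * (\<Prod>j\<in>S. z j))"
    by (intro sum.cong refl arg_cong2[where f = "(*)"] prod.cong) auto
  also have "(\<Sum>S\<in>{S \<in> ksubsets n (Suc k). i \<in> S}. ?f S) =
        (\<Sum>T\<in>{T \<in> ksubsets n k. i \<notin> T}. ?f (insert i T))"
    by (rule sum_ksubsets_containing) fact
  also have "\<dots> = (\<Sum>T\<in>{T \<in> ksubsets n k. i \<notin> T}. c * (link i \<mu> T * (\<Prod>j\<in>T. z j)))"
  proof (intro sum.cong refl)
    fix T assume T: "T \<in> {T \<in> ksubsets n k. i \<notin> T}"
    then have "(\<Prod>j\<in>T. (z(i := c)) j) = (\<Prod>j\<in>T. z j)"
      by (intro prod.cong) auto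
    with T show "?f (insert i T) = c * (link i \<mu> T * (\<Prod>j\<in>T. z j))"
      using ksubsetsD(2)[of T n k] by (simp add: link_def)
  qed
  also have "\<dots> = c * gen_poly n k (link i \<mu>) z"
    unfolding gen_poly_def sum_distrib_left sum.inter_filter [OF finite_ksubsets]
    by (intro sum.cong) (auto simp: link_def)
  finally show ?thesis .
qed

lemma log_concaveD:
  assumes "log_concave n g" "0 < c" "c < 1"
    and "\<And>i. i \<in> {1..n} \<Longrightarrow> 0 \<le> x i" "\<And>i. i \<in> {1..n} \<Longrightarrow> 0 \<le> y i"
  shows "g x powr c * g y powr (1 - c) \<le> g (\<lambda>i. c * x i + (1 - c) * y i)"
  using assms by (simp add: log_concave_def)

text \<open>Since \<open>g\<close> is affine in \<open>z i\<close>, the generating polynomial of the link is the limit of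
  \<open>g(z) / z i\<close> as \<open>z i \<rightarrow> \<infinity>\<close>.\<close>

lemma log_concave_link:
  assumes i: "i \<in> {1..n}" and lc: "log_concave n (gen_poly n (Suc k) \<mu>)"
    and nn: "\<And>S. S \<in> ksubsets n (Suc k) \<Longrightarrow> 0 \<le> \<mu> S"
  shows "log_concave n (gen_poly n k (link i \<mu>))"
  unfolding log_concave_def
proof (intro allI ballI impI)
  fix x y :: "nat \<Rightarrow> real" and c :: real
  assume c: "c \<in> {0<..<1}" and x: "\<forall>i\<in>{1..n}. 0 \<le> x i" and y: "\<forall>i\<in>{1..n}. 0 \<le> y i"
  define w where "w = (\<lambda>i. c * x i + (1 - c) * y i)"
  define H where "H = gen_poly n k (link i \<mu>)"
  define R where "R = (\<lambda>z. \<Sum>S\<in>{S \<in> ksubsets n (Suc k). i \<notin> S}. \<mu> S * (\<Prod>j\<in>S. z j))"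
  have H0: "0 \<le> H z" if "\<forall>i\<in>{1..n}. 0 \<le> z i" for z
    unfolding H_def using that i nn by (intro gen_poly_nonneg link_nonneg) auto
  have R0: "0 \<le> R z" if "\<forall>i\<in>{1..n}. 0 \<le> z i" for z
    unfolding R_def using that nn
    by (intro sum_nonneg mult_nonneg_nonneg prod_nonneg) (auto dest: ksubsets_mem)
  \<comment> \<open>Giving both points the same coordinate \<open>N\<close> at \<open>i\<close>
    makes their combination have it too. As \<open>N powr c * N powr (1 - c) = N\<close>, the whole
    inequality can be divided by \<open>N\<close>.\<close>
  have ineq: "(H x + R x / N) powr c * (H y + R y / N) powr (1 - c) \<le> H w + R w / N"
    if N: "N > 0" for N
  proof -
    have "(\<lambda>j. c * (x(i := N)) j + (1 - c) * (y(i := N)) j) = w(i := N)"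
      by (auto simp: w_def fun_eq_iff algebra_simps)
    moreover have "gen_poly n (Suc k) \<mu> (\<lambda>j. c * (x(i := N)) j + (1 - c) * (y(i := N)) j)
       \<ge> gen_poly n (Suc k) \<mu> (x(i := N)) powr c * gen_poly n (Suc k) \<mu> (y(i := N)) powr (1 - c)"
      using c x y N by (intro log_concaveD [OF lc]) auto
    ultimately have "(N * H x + R x) powr c * (N * H y + R y) powr (1 - c) \<le> N * H w + R w"
      by (simp add: gen_poly_Suc_upd [OF i] H_def R_def)
    moreover have "N * H z + R z = N * (H z + R z / N)" for z
      using N by (simp add: field_simps)
    ultimately have "(N * (H x + R x / N)) powr c * (N * (H y + R y / N)) powr (1 - c)
        \<le> N * (H w + R w / N)"
      by simp
    also have "(N * (H x + R x / N)) powr c * (N * (H y + R y / N)) powr (1 - c) =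
        (N powr c * N powr (1 - c)) * ((H x + R x / N) powr c * (H y + R y / N) powr (1 - c))"
      using N H0[OF x] H0[OF y] R0[OF x] R0[OF y] by (simp add: powr_mult)
    also have "N powr c * N powr (1 - c) = N"
      using N by (simp flip: powr_add)
    finally show ?thesis using N by simp
  qed
  have lim: "(\<lambda>m. H z + R z / real (Suc m)) \<longlonglongrightarrow> H z" for z
    using tendsto_add[OF tendsto_const[of "H z"] LIMSEQ_Suc[OF lim_const_over_n[of "R z"]]] by simp
  \<comment> \<open>The limit may be 0; there the convergence of \<open>powr\<close> needs
    eventually nonnegative bases and a positive exponent.\<close>
  have ev: "\<forall>\<^sub>F m in sequentially. 0 \<le> H z + R z / real (Suc m)" if "\<forall>i\<in>{1..n}. 0 \<le> z i" for z
    using H0[OF that] R0[OF that] by (intro always_eventually allI add_nonneg_nonneg divide_nonneg_nonneg) auto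
  have "(\<lambda>m. (H x + R x / real (Suc m)) powr c * (H y + R y / real (Suc m)) powr (1 - c))
       \<longlonglongrightarrow> H x powr c * H y powr (1 - c)"
    using c ev[OF x] ev[OF y] lim
    by (intro tendsto_mult tendsto_powr' tendsto_const) auto
  from tendsto_le[OF _ lim[of w] this] have "H x powr c * H y powr (1 - c) \<le> H w"
    using ineq by (auto intro!: always_eventually)
  then show "gen_poly n k (link i \<mu>) (\<lambda>i. c * x i + (1 - c) * y i) \<ge>
      gen_poly n k (link i \<mu>) x powr c * gen_poly n k (link i \<mu>) y powr (1 - c)"
    by (simp add: H_def w_def)
qed

subsection \<open>Negative correlation up to a factor of two\<close>

text \<open>Log-concavity is used only for the three collinear points \<open>1 - v\<close>, \<open>1\<close>, \<open>1 + v\<close>, with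
  \<open>v\<close> proportional to \<open>\<partial>\<^sub>jg e\<^sub>i + \<partial>\<^sub>ig e\<^sub>j\<close>.\<close>

lemma upmass_pair_bound:
  assumes lc: "log_concave n (gen_poly n k \<mu>)"
    and nn: "\<And>S. S \<in> ksubsets n k \<Longrightarrow> 0 \<le> \<mu> S"
    and ij: "i \<noteq> j"
  shows "upmass n k \<mu> {i, j} * upmass n k \<mu> {} \<le> 2 * upmass n k \<mu> {i} * upmass n k \<mu> {j}"
proof -
  define M p q r where "M = upmass n k \<mu> {}" and "p = upmass n k \<mu> {i}"
    and "q = upmass n k \<mu> {j}" and "r = upmass n k \<mu> {i, j}"
  have pos: "0 \<le> M" "0 \<le> p" "0 \<le> q" "0 \<le> r"
    using nn by (auto simp: M_def p_def q_def r_def intro!: upmass_nonneg)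
  have rle: "r \<le> p" "r \<le> q"
    unfolding p_def q_def r_def using nn by (auto intro!: upmass_antimono)
  define z where "z = (\<lambda>a b l. if l = i then 1 + a else if l = j then 1 + b else (1::real))"
  have exp: "gen_poly n k \<mu> (z a b) = M + a * p + b * q + a * b * r" for a b
  proof -
    have "gen_poly n k \<mu> (z a b) = (\<Sum>S\<in>ksubsets n k. \<mu> S + a * (if {i} \<subseteq> S then \<mu> S else 0)
        + b * (if {j} \<subseteq> S then \<mu> S else 0) + a * b * (if {i, j} \<subseteq> S then \<mu> S else 0))"
      unfolding gen_poly_def
    proof (intro sum.cong refl)
      fix S assume "S \<in> ksubsets n k"
      then have fin: "finite S" by (rule ksubsetsD)
      have "(\<Prod>l\<in>S. z a b l) =
          (\<Prod>l\<in>S. (if l = i then 1 + a else 1) * (if l = j then 1 + b else 1))"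
        using ij by (intro prod.cong) (auto simp: z_def)
      also have "\<dots> = (if i \<in> S then 1 + a else 1) * (if j \<in> S then 1 + b else 1)"
        using fin by (simp add: prod.distrib prod.delta)
      finally show "\<mu> S * (\<Prod>l\<in>S. z a b l) = \<mu> S + a * (if {i} \<subseteq> S then \<mu> S else 0)
        + b * (if {j} \<subseteq> S then \<mu> S else 0) + a * b * (if {i, j} \<subseteq> S then \<mu> S else 0)"
        by (auto simp: algebra_simps)
    qed
    then show ?thesis
      by (simp add: sum.distrib sum_distrib_left upmass_eq_sum_if M_def p_def q_def r_def)
  qed
  show ?thesis
  proof (cases "p = 0 \<or> q = 0")
    case True
    with rle pos have "r = 0" by linarith
    with pos show ?thesis by (simp flip: M_def p_def q_def r_def)
  next
    case False
    with pos have pq: "p > 0" "q > 0" by auto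
    \<comment> \<open>The scaling keeps \<open>1 + v\<close> and \<open>1 - v\<close> in the
      nonnegative orthant; it cancels at the end.\<close>
    define s where "s = 1 / (p + q)"
    have s: "s > 0" "s * q \<le> 1" "s * p \<le> 1"
      using pq by (auto simp: s_def field_simps)
    define A B where "A = gen_poly n k \<mu> (z (s * q) (s * p))"
      and "B = gen_poly n k \<mu> (z (- (s * q)) (- (s * p)))"
    have zmid: "(\<lambda>l. 1 / 2 * z (s * q) (s * p) l + (1 - 1 / 2) * z (- (s * q)) (- (s * p)) l) = z 0 0"
      by (auto simp: z_def fun_eq_iff field_simps)
    have z0: "\<forall>l\<in>{1..n}. 0 \<le> z (s * q) (s * p) l" "\<forall>l\<in>{1..n}. 0 \<le> z (- (s * q)) (- (s * p)) l"
      using s pq by (auto simp: z_def intro!: add_nonneg_nonneg)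
    have AB: "0 \<le> A" "0 \<le> B"
      unfolding A_def B_def using z0 nn by (auto intro!: gen_poly_nonneg)
    have "A powr (1/2) * B powr (1 - 1/2) \<le> gen_poly n k \<mu> (z 0 0)"
      unfolding A_def B_def zmid [symmetric] using z0 by (intro log_concaveD [OF lc]) auto
    then have "sqrt (A * B) \<le> M"
      using AB by (simp add: exp powr_half_sqrt real_sqrt_mult)
    then have "A * B \<le> M\<^sup>2"
      using AB pos by (simp add: real_sqrt_le_iff sqrt_le_D)
    moreover have "A = M + s\<^sup>2 * (p * q * r) + s * (2 * p * q)"
      "B = M + s\<^sup>2 * (p * q * r) - s * (2 * p * q)"
      by (simp_all add: A_def B_def exp power2_eq_square algebra_simps)
    ultimately have "(M + s\<^sup>2 * (p * q * r))\<^sup>2 - (s * (2 * p * q))\<^sup>2 \<le> M\<^sup>2"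
      by (simp add: power2_eq_square algebra_simps)
    \<comment> \<open>Only the square of the second-order term is dropped. What remains compares the
      second-order term with the square of the first-order one.\<close>
    moreover have "M\<^sup>2 + 2 * M * s\<^sup>2 * (p * q * r) \<le> (M + s\<^sup>2 * (p * q * r))\<^sup>2"
      by (simp add: power2_sum)
    ultimately have "2 * M * s\<^sup>2 * (p * q * r) \<le> (s * (2 * p * q))\<^sup>2"
      by linarith
    then have "(2 * s\<^sup>2 * p * q) * (r * M) \<le> (2 * s\<^sup>2 * p * q) * (2 * p * q)"
      by (simp add: power2_eq_square algebra_simps)
    moreover have "2 * s\<^sup>2 * p * q > 0" using s pq by simp
    ultimately have "r * M \<le> 2 * p * q" by (rule mult_left_le_imp_le)
    then show ?thesis by (simp add: M_def p_def q_def r_def)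
  qed
qed

lemma upmass_0_insert [simp]: "upmass n 0 \<mu> (insert i T) = 0"
  by (auto simp: upmass_def intro!: sum.neutral)

text \<open>Conditioning on \<open>B\<close> means taking successive links, which stay log-concave.
  The induction removes the elements of \<open>B\<close> one by one and ends with the pair
  bound.\<close>

lemma upmass_insert_bound:
  assumes "log_concave n (gen_poly n k \<mu>)" "\<And>S. S \<in> ksubsets n k \<Longrightarrow> 0 \<le> \<mu> S"
    and "finite B" "B \<subseteq> {1..n}" "i \<notin> B" "j \<notin> B" "i \<noteq> j"
  shows "upmass n k \<mu> (insert i (insert j B)) * upmass n k \<mu> B
       \<le> 2 * upmass n k \<mu> (insert i B) * upmass n k \<mu> (insert j B)"
  using assms(3,1,2,4-)
proof (induction B arbitrary: k \<mu> rule: finite_induct)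
  case empty
  then show ?case using upmass_pair_bound[of n k \<mu> i j] by simp
next
  case (insert b B)
  show ?case
  proof (cases k)
    case 0
    then show ?thesis by simp
  next
    case (Suc k')
    have b: "b \<in> {1..n}" using insert by auto
    have "log_concave n (gen_poly n k' (link b \<mu>))"
      using insert.prems b Suc by (intro log_concave_link) auto
    moreover have "0 \<le> link b \<mu> S" if "S \<in> ksubsets n k'" for S
      using insert.prems b Suc that by (intro link_nonneg) auto
    ultimately have "upmass n k' (link b \<mu>) (insert i (insert j B)) * upmass n k' (link b \<mu>) B
       \<le> 2 * upmass n k' (link b \<mu>) (insert i B) * upmass n k' (link b \<mu>) (insert j B)"
      using insert.prems by (intro insert.IH) auto
    then show ?thesis
      using insert.prems insert.hyps b by (simp add: upmass_link Suc insert_commute)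
  qed
qed

text \<open>In terms of conditional probabilities, each element of \<open>U\<close> added to the
  condition raises the chance of \<open>x\<close> by a factor of at most 2; the factors
  telescope.\<close>

lemma upmass_Un_bound:
  assumes lc: "log_concave n (gen_poly n k \<mu>)"
    and nn: "\<And>S. S \<in> ksubsets n k \<Longrightarrow> 0 \<le> \<mu> S"
    and "finite U" "finite B" "B \<subseteq> {1..n}" "U \<subseteq> {1..n}" "x \<notin> B \<union> U" "B \<inter> U = {}"
  shows "upmass n k \<mu> (insert x (B \<union> U)) * upmass n k \<mu> B
       \<le> 2 ^ card U * upmass n k \<mu> (insert x B) * upmass n k \<mu> (B \<union> U)"
  using assms(3-)
proof (induction U rule: finite_induct)
  case empty
  then show ?case by simp
next
  case (insert u U)
  let ?m = "upmass n k \<mu>"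
  have nonneg: "0 \<le> ?m T" for T using nn by (rule upmass_nonneg)
  have step: "?m (insert x (insert u (B \<union> U))) * ?m (B \<union> U)
      \<le> 2 * ?m (insert x (B \<union> U)) * ?m (insert u (B \<union> U))"
    using insert by (intro upmass_insert_bound lc nn) auto
  have IH: "?m (insert x (B \<union> U)) * ?m B \<le> 2 ^ card U * ?m (insert x B) * ?m (B \<union> U)"
    using insert by auto
  show ?case
  \<comment> \<open>The two inequalities are chained by cancelling this mass. If it is 0, the
    left-hand side vanishes.\<close>
  proof (cases "?m (B \<union> U) = 0")
    case True
    moreover have "?m (insert x (B \<union> insert u U)) \<le> ?m (B \<union> U)"
      using nn by (intro upmass_antimono) auto
    ultimately have "?m (insert x (B \<union> insert u U)) = 0"
      using nonneg[of "insert x (B \<union> insert u U)"] by simp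
    then show ?thesis using nonneg by simp
  next
    case False
    with nonneg have pos: "?m (B \<union> U) > 0" by (simp add: order_less_le)
    have "?m (insert x (insert u (B \<union> U))) * ?m (B \<union> U) * ?m B
        \<le> 2 * ?m (insert x (B \<union> U)) * ?m (insert u (B \<union> U)) * ?m B"
      using step nonneg by (intro mult_right_mono) auto
    also have "\<dots> = 2 * ?m (insert u (B \<union> U)) * (?m (insert x (B \<union> U)) * ?m B)"
      by simp
    also have "\<dots> \<le> 2 * ?m (insert u (B \<union> U)) * (2 ^ card U * ?m (insert x B) * ?m (B \<union> U))"
      using IH nonneg by (intro mult_left_mono) auto
    finally have "?m (B \<union> U) * (?m (insert x (insert u (B \<union> U))) * ?m B)
        \<le> ?m (B \<union> U) * (2 * 2 ^ card U * ?m (insert x B) * ?m (insert u (B \<union> U)))"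
      by (simp add: algebra_simps)
    with pos insert.hyps show ?thesis by simp
  qed
qed

subsection \<open>Entropy contraction\<close>

text \<open>Unnormalised: \<open>entropy n k \<nu> \<mu> j\<close> is \<open>k choose j\<close> times the relative entropy of the
  distributions of a uniform \<open>j\<close>-subset when \<open>\<nu>\<close> and \<open>\<mu>\<close> are probability distributions.\<close>

definition entropy :: "nat \<Rightarrow> nat \<Rightarrow> (nat set \<Rightarrow> real) \<Rightarrow> (nat set \<Rightarrow> real) \<Rightarrow> nat \<Rightarrow> real" where
  "entropy n k \<nu> \<mu> j =
     (\<Sum>T\<in>ksubsets n j. upmass n k \<nu> T * ln (upmass n k \<nu> T / upmass n k \<mu> T))"

text \<open>Absolute continuity together with nonnegativity. It makes division by 0 harmless in the
  entropy: every quotient by 0 comes with a factor 0.\<close>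

definition dominated :: "nat \<Rightarrow> nat \<Rightarrow> (nat set \<Rightarrow> real) \<Rightarrow> (nat set \<Rightarrow> real) \<Rightarrow> bool" where
  "dominated n k \<nu> \<mu> \<longleftrightarrow>
     (\<forall>S\<in>ksubsets n k. 0 \<le> \<mu> S \<and> 0 \<le> \<nu> S \<and> (\<mu> S = 0 \<longrightarrow> \<nu> S = 0))"

lemma dominatedD:
  assumes "dominated n k \<nu> \<mu>" "S \<in> ksubsets n k"
  shows "0 \<le> \<mu> S" "0 \<le> \<nu> S" "\<mu> S = 0 \<Longrightarrow> \<nu> S = 0"
  using assms by (auto simp: dominated_def)

lemma dominated_upmass_0:
  assumes "dominated n k \<nu> \<mu>" "upmass n k \<mu> T = 0"
  shows "upmass n k \<nu> T = 0"
proof -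
  have "\<forall>S\<in>{S \<in> ksubsets n k. T \<subseteq> S}. \<mu> S = 0"
    using assms(2) unfolding upmass_def
    by (subst (asm) sum_nonneg_eq_0_iff) (auto dest: dominatedD[OF assms(1)])
  then show ?thesis
    unfolding upmass_def by (intro sum.neutral) (auto dest: dominatedD[OF assms(1)])
qed

lemma dominated_link:
  assumes "dominated n (Suc k) \<nu> \<mu>" "i \<in> {1..n}"
  shows "dominated n k (link i \<nu>) (link i \<mu>)"
  unfolding dominated_def
proof
  fix S assume S: "S \<in> ksubsets n k"
  show "0 \<le> link i \<mu> S \<and> 0 \<le> link i \<nu> S \<and> (link i \<mu> S = 0 \<longrightarrow> link i \<nu> S = 0)"
  proof (cases "i \<in> S")
    case False
    from insert_in_ksubsets[OF S assms(2) this] dominatedD[OF assms(1)] False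
    show ?thesis by (auto simp: link_def)
  qed (simp add: link_def)
qed

text \<open>Chain rule for relative entropy. Each set of size \<open>Suc j\<close> arises in the
  links of its \<open>Suc j\<close> elements, and since entropies are unnormalised, the links are
  summed without weights.\<close>

lemma sum_entropy_link:
  "(\<Sum>i\<in>{1..n}. entropy n k (link i \<nu>) (link i \<mu>) j) = real (Suc j) * entropy n (Suc k) \<nu> \<mu> (Suc j)"
proof -
  let ?F = "\<lambda>T. upmass n (Suc k) \<nu> T * ln (upmass n (Suc k) \<nu> T / upmass n (Suc k) \<mu> T)"
  have "(\<Sum>i\<in>{1..n}. entropy n k (link i \<nu>) (link i \<mu>) j) =
        (\<Sum>i\<in>{1..n}. \<Sum>T\<in>ksubsets n j. if i \<notin> T then ?F (insert i T) else 0)"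
    unfolding entropy_def
    by (intro sum.cong refl) (auto simp: upmass_link upmass_link_mem)
  also have "\<dots> = (\<Sum>T\<in>ksubsets n j. \<Sum>i\<in>{1..n}. if i \<notin> T then ?F (insert i T) else 0)"
    by (rule sum.swap)
  also have "\<dots> = (\<Sum>T\<in>ksubsets n j. \<Sum>i\<in>{1..n} - T. ?F (insert i T))"
    by (intro sum.cong refl sum.mono_neutral_cong_right) auto
  also have "\<dots> = (\<Sum>S\<in>ksubsets n (Suc j). \<Sum>i\<in>S. ?F S)"
    by (rule sum_ksubsets_Suc [symmetric])
  also have "\<dots> = real (Suc j) * entropy n (Suc k) \<nu> \<mu> (Suc j)"
    unfolding entropy_def sum_distrib_left
    by (intro sum.cong refl) (simp add: ksubsetsD)
  finally show ?thesis .
qed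

section \<open>Entropy of the one-element marginals\<close>

lemma entropy_1:
  "entropy n k \<nu> \<mu> 1 = (\<Sum>i\<in>{1..n}. upmass n k \<nu> {i} * ln (upmass n k \<nu> {i} / upmass n k \<mu> {i}))"
proof -
  have "ksubsets n 1 = (\<lambda>i. {i}) ` {1..n}"
    by (auto simp: ksubsets_def card_1_singleton_iff)
  then show ?thesis by (simp add: entropy_def sum.reindex)
qed

lemma entropy_0:
  "entropy n k \<nu> \<mu> 0 = upmass n k \<nu> {} * ln (upmass n k \<nu> {} / upmass n k \<mu> {})"
  by (simp add: entropy_def)

lemma entropy_top: "entropy n k \<nu> \<mu> k = (\<Sum>S\<in>ksubsets n k. \<nu> S * ln (\<nu> S / \<mu> S))"
  by (simp add: entropy_def upmass_ksubset)

text \<open>The tangent of \<open>log g\<close> at the all-ones vector lies above \<open>log g\<close>.\<close>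

lemma gen_poly_le_of_tangent:
  assumes lc: "log_concave n (gen_poly n k \<mu>)"
    and nn: "\<And>S. S \<in> ksubsets n k \<Longrightarrow> 0 \<le> \<mu> S"
    and M: "0 < upmass n k \<mu> {}"
    and z: "\<And>i. i \<in> {1..n} \<Longrightarrow> 0 \<le> z i"
    and tangent: "(\<Sum>i\<in>{1..n}. upmass n k \<mu> {i} * (z i - 1)) = 0"
  shows "gen_poly n k \<mu> z \<le> upmass n k \<mu> {}"
proof (rule ccontr)
  define M where "M = upmass n k \<mu> {}"
  define G where "G = gen_poly n k \<mu> z"
  define l where "l = ln (G / M)"
  define d where "d = (\<lambda>S. \<Sum>i\<in>S. z i - 1)"
  assume "\<not> ?thesis"
  then have GM: "G > M" "M > 0" using M by (auto simp: G_def M_def)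
  then have l: "l > 0" by (simp add: l_def)
  have d0: "(\<Sum>S\<in>ksubsets n k. \<mu> S * d S) = 0"
    using tangent sum_upmass_insert[of n k \<mu> "{}" "\<lambda>i. z i - 1"] by (simp add: d_def)
  \<comment> \<open>Both terms equal \<open>M\<close> at 0. The first has derivative 0 there by
    tangency and the second has positive slope, so \<open>h\<close> is negative just to the right of
    0; log-concavity and \<open>1 + u \<le> exp u\<close> force the opposite sign.\<close>
  define h where "h = (\<lambda>c. (\<Sum>S\<in>ksubsets n k. \<mu> S * exp (c * d S)) - M * exp (c * l))"
  have "(h has_real_derivative (\<Sum>S\<in>ksubsets n k. \<mu> S * d S) - M * l) (at 0)"
    unfolding h_def by (auto intro!: derivative_eq_intros simp: mult.commute)
  then have "(h has_real_derivative - (M * l)) (at 0)"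
    using d0 by simp
  then obtain e where e: "e > 0" "\<And>c. 0 < c \<Longrightarrow> c < e \<Longrightarrow> h c < h 0"
    using DERIV_neg_dec_right[of h "- (M * l)" 0] GM l by auto
  define c where "c = min (e / 2) (1 / 2)"
  have c: "0 < c" "c < e" "c < 1" using e(1) by (auto simp: c_def)
  have "h 0 = 0" by (simp add: h_def M_def upmass_empty)
  with e(2)[OF c(1,2)] have less: "(\<Sum>S\<in>ksubsets n k. \<mu> S * exp (c * d S)) < M * exp (c * l)"
    by (simp add: h_def)
  have "M powr (1 - c) * G powr c = M * exp (c * l)"
  proof -
    have "M powr (1 - c) * G powr c = exp (ln M + c * (ln G - ln M))"
      using GM by (simp add: powr_def algebra_simps flip: exp_add)
    also have "\<dots> = M * exp (c * l)"
      using GM by (simp add: l_def ln_div exp_add)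
    finally show ?thesis .
  qed
  moreover have "M powr (1 - c) * G powr c \<le> gen_poly n k \<mu> (\<lambda>i. c * z i + (1 - c) * 1)"
  proof -
    have "gen_poly n k \<mu> (\<lambda>_. 1) = M" by (simp add: gen_poly_def M_def upmass_empty)
    then show ?thesis
      using log_concaveD[OF lc c(1,3), of z "\<lambda>_. 1"] z by (simp add: G_def mult.commute)
  qed
  moreover have "gen_poly n k \<mu> (\<lambda>i. c * z i + (1 - c) * 1) \<le> (\<Sum>S\<in>ksubsets n k. \<mu> S * exp (c * d S))"
    unfolding gen_poly_def
  proof (intro sum_mono mult_left_mono nn)
    fix S assume S: "S \<in> ksubsets n k"
    have "(\<Prod>i\<in>S. c * z i + (1 - c) * 1) \<le> (\<Prod>i\<in>S. exp (c * (z i - 1)))"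
    proof (rule prod_mono, safe)
      fix i assume "i \<in> S"
      then have "0 \<le> z i" using S ksubsets_mem z by blast
      then show "0 \<le> c * z i + (1 - c) * 1" using c by simp
      show "c * z i + (1 - c) * 1 \<le> exp (c * (z i - 1))"
        using exp_ge_add_one_self[of "c * (z i - 1)"] by (simp add: algebra_simps)
    qed
    also have "\<dots> = exp (c * d S)"
      using ksubsetsD(2)[OF S] by (simp add: exp_sum d_def sum_distrib_left)
    finally show "(\<Prod>i\<in>S. c * z i + (1 - c) * 1) \<le> exp (c * d S)" .
  qed
  ultimately show False using less by linarith
qed

text \<open>The tangent inequality at \<open>z\<^sub>i = (q\<^sub>i / N) / (p\<^sub>i / M)\<close>, the ratio of the marginals, combined
  with Gibbs' inequality for \<open>\<nu>\<close> against the tilted weights \<open>\<mu> S * (\<Prod>i\<in>S. z\<^sub>i)\<close>.\<close>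

lemma entropy_1_le:
  assumes lc: "log_concave n (gen_poly n k \<mu>)" and dom: "dominated n k \<nu> \<mu>"
  shows "entropy n k \<nu> \<mu> 1 \<le> entropy n k \<nu> \<mu> k + (real k - 1) * entropy n k \<nu> \<mu> 0"
proof -
  define M N where "M = upmass n k \<mu> {}" and "N = upmass n k \<nu> {}"
  define p q where "p = (\<lambda>i. upmass n k \<mu> {i})" and "q = (\<lambda>i. upmass n k \<nu> {i})"
  note domD = dominatedD[OF dom]
  have nonneg: "0 \<le> M" "0 \<le> N" "\<And>i. 0 \<le> p i" "\<And>i. 0 \<le> q i"
    unfolding M_def N_def p_def q_def by (auto intro!: upmass_nonneg domD)
  have sum_pw: "(\<Sum>i\<in>{1..n}. p i * w i) = (\<Sum>S\<in>ksubsets n k. \<mu> S * (\<Sum>i\<in>S. w i))" for w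
    using sum_upmass_insert[of n k \<mu> "{}" w] by (simp add: p_def)
  have sum_qw: "(\<Sum>i\<in>{1..n}. q i * w i) = (\<Sum>S\<in>ksubsets n k. \<nu> S * (\<Sum>i\<in>S. w i))" for w
    using sum_upmass_insert[of n k \<nu> "{}" w] by (simp add: q_def)
  have sum_p: "(\<Sum>i\<in>{1..n}. p i) = k * M"
    using sum_pw[of "\<lambda>_. 1"] by (simp add: ksubsetsD M_def upmass_empty sum_distrib_left mult.commute)
  have sum_q: "(\<Sum>i\<in>{1..n}. q i) = k * N"
    using sum_qw[of "\<lambda>_. 1"] by (simp add: ksubsetsD N_def upmass_empty sum_distrib_left mult.commute)
  have q0: "q i = 0" if "p i = 0" for i
    using dominated_upmass_0[OF dom] that by (simp add: p_def q_def)
  show ?thesis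
  proof (cases "N = 0")
    case True
    have "\<nu> S = 0" if "S \<in> ksubsets n k" for S
      using True that domD(2) unfolding N_def upmass_empty by (subst (asm) sum_nonneg_eq_0_iff) auto
    then have "upmass n k \<nu> T = 0" for T by (auto simp: upmass_def intro!: sum.neutral)
    then show ?thesis by (simp add: entropy_def)
  next
    case False
    then have N: "N > 0" using nonneg by simp
    have M: "M > 0"
      using dominated_upmass_0[OF dom] False nonneg by (force simp: M_def N_def order_less_le)
    \<comment> \<open>Where \<open>p i = 0\<close> also \<open>q i = 0\<close>, so the default
      quotient 0 still satisfies \<open>pz\<close>.\<close>
    define z where "z = (\<lambda>i. q i / p i * (M / N))"
    have z0: "0 \<le> z i" for i using nonneg by (simp add: z_def)
    have pz: "p i * z i = q i * (M / N)" for i using q0[of i] by (simp add: z_def)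
    have "(\<Sum>i\<in>{1..n}. p i * (z i - 1)) = (\<Sum>i\<in>{1..n}. q i) * (M / N) - (\<Sum>i\<in>{1..n}. p i)"
      by (simp only: right_diff_distrib sum_subtractf pz sum_distrib_right mult_1_right)
    \<comment> \<open>Rescaling by \<open>M / N\<close> makes both marginal vectors sum to
      \<open>k * M\<close>; this is the tangency condition.\<close>
    then have "(\<Sum>i\<in>{1..n}. p i * (z i - 1)) = 0"
      unfolding sum_p sum_q using N by simp
    then have G: "gen_poly n k \<mu> z \<le> M"
      unfolding M_def p_def
      by (intro gen_poly_le_of_tangent lc z0 domD(1)) (use M in \<open>auto simp: M_def\<close>)
    have tilted: "\<nu> S * (\<Sum>i\<in>S. ln (z i)) + \<nu> S * ln (N / M) - \<nu> S * ln (\<nu> S / \<mu> S)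
        \<le> (N / M) * (\<mu> S * (\<Prod>i\<in>S. z i)) - \<nu> S" if S: "S \<in> ksubsets n k" for S
    proof (cases "\<nu> S = 0")
      case True
      then show ?thesis using N M domD(1)[OF S] z0 by (simp add: prod_nonneg)
    next
      case False
      then have pos: "\<nu> S > 0" "\<mu> S > 0" using domD[OF S] by (auto simp: order_less_le)
      have zpos: "z i > 0" if i: "i \<in> S" for i
      proof -
        have "\<nu> S \<le> q i"
          unfolding q_def upmass_ksubset[OF S, of \<nu>, symmetric]
          using i by (intro upmass_antimono domD(2)) auto
        then have "q i > 0" using pos by simp
        moreover then have "p i \<noteq> 0" using q0 by force
        ultimately show ?thesis using nonneg(3)[of i] M N by (simp add: z_def order_less_le)
      qed
      \<comment> \<open>The rescaled tilted weight relative to \<open>\<nu> S\<close>;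
        \<open>ln y \<le> y - 1\<close> is the pointwise form of Gibbs' inequality.\<close>
      define y where "y = (N / M) * (\<mu> S * (\<Prod>i\<in>S. z i)) / \<nu> S"
      have Pz: "(\<Prod>i\<in>S. z i) > 0" using zpos by (simp add: prod_pos)
      have "y > 0" unfolding y_def using Pz M N pos by simp
      have "ln y = (\<Sum>i\<in>S. ln (z i)) + ln (N / M) - ln (\<nu> S / \<mu> S)"
        unfolding y_def using Pz M N pos zpos
        by (simp add: ln_mult ln_div ln_prod ksubsetsD(2)[OF S] less_imp_neq[THEN not_sym])
      then have "\<nu> S * (\<Sum>i\<in>S. ln (z i)) + \<nu> S * ln (N / M) - \<nu> S * ln (\<nu> S / \<mu> S) = \<nu> S * ln y"
        by (simp only: distrib_left right_diff_distrib)
      also have "\<dots> \<le> \<nu> S * (y - 1)"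
        using pos ln_le_minus_one[OF \<open>y > 0\<close>] by simp
      also have "\<dots> = (N / M) * (\<mu> S * (\<Prod>i\<in>S. z i)) - \<nu> S"
        using pos by (simp add: y_def right_diff_distrib)
      finally show ?thesis .
    qed
    have "(\<Sum>S\<in>ksubsets n k. \<nu> S * (\<Sum>i\<in>S. ln (z i))) + N * ln (N / M) - entropy n k \<nu> \<mu> k
       = (\<Sum>S\<in>ksubsets n k. \<nu> S * (\<Sum>i\<in>S. ln (z i)) + \<nu> S * ln (N / M) - \<nu> S * ln (\<nu> S / \<mu> S))"
      by (simp add: sum.distrib sum_subtractf entropy_top N_def upmass_empty sum_distrib_right)
    also have "\<dots> \<le> (\<Sum>S\<in>ksubsets n k. (N / M) * (\<mu> S * (\<Prod>i\<in>S. z i)) - \<nu> S)"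
      by (intro sum_mono tilted)
    also have "\<dots> = (N / M) * gen_poly n k \<mu> z - N"
      by (simp add: sum_subtractf gen_poly_def sum_distrib_left N_def upmass_empty)
    also have "\<dots> \<le> (N / M) * M - N" using G M N by (intro diff_right_mono mult_left_mono) auto
    also have "\<dots> = 0" using M by simp
    finally have A: "(\<Sum>i\<in>{1..n}. q i * ln (z i)) + N * ln (N / M) \<le> entropy n k \<nu> \<mu> k"
      unfolding sum_qw by simp
    have "q i * ln (z i) = q i * ln (q i / p i) - q i * ln (N / M)" for i
    proof (cases "q i = 0")
      case False
      then have "q i > 0" "p i > 0" using q0[of i] nonneg(3,4)[of i] by (auto simp: order_less_le)
      then show ?thesis using M N by (simp add: z_def ln_mult ln_div algebra_simps)
    qed simp
    then have "(\<Sum>i\<in>{1..n}. q i * ln (z i)) = (\<Sum>i\<in>{1..n}. q i * ln (q i / p i))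
        - (\<Sum>i\<in>{1..n}. q i) * ln (N / M)"
      by (simp only: sum_subtractf sum_distrib_right)
    then have "(\<Sum>i\<in>{1..n}. q i * ln (z i)) = entropy n k \<nu> \<mu> 1 - k * (N * ln (N / M))"
      unfolding sum_q entropy_1 by (simp only: p_def q_def mult.assoc)
    with A show ?thesis
      unfolding entropy_0 M_def N_def by (simp add: algebra_simps)
  qed
qed

text \<open>Summing the induction hypothesis over all links relates the two highest levels and level
  1; the bound on level 1 closes the recursion. For equal total masses, dividing by the binomial
  factor \<open>Suc k\<close> gives a contraction by \<open>1 - 1 / Suc k\<close>.\<close>

lemma entropy_contraction:
  assumes "log_concave n (gen_poly n (Suc k) \<mu>)" "dominated n (Suc k) \<nu> \<mu>"
  shows "entropy n (Suc k) \<nu> \<mu> k \<le> real k * entropy n (Suc k) \<nu> \<mu> (Suc k) + entropy n (Suc k) \<nu> \<mu> 0"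
  using assms
proof (induction k arbitrary: \<mu> \<nu>)
  case 0
  then show ?case by simp
next
  case (Suc k)
  let ?E = "entropy n (Suc (Suc k)) \<nu> \<mu>"
  have "(\<Sum>i\<in>{1..n}. entropy n (Suc k) (link i \<nu>) (link i \<mu>) k)
      \<le> (\<Sum>i\<in>{1..n}. real k * entropy n (Suc k) (link i \<nu>) (link i \<mu>) (Suc k)
            + entropy n (Suc k) (link i \<nu>) (link i \<mu>) 0)"
    using Suc.prems
    by (intro sum_mono Suc.IH log_concave_link dominated_link) (auto dest: dominatedD)
  then have "real (Suc k) * ?E (Suc k) \<le> real k * (real (Suc (Suc k)) * ?E (Suc (Suc k))) + ?E 1"
    by (simp only: sum.distrib sum_distrib_left [symmetric] sum_entropy_link) simp
  also have "?E 1 \<le> ?E (Suc (Suc k)) + real (Suc k) * ?E 0"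
    using entropy_1_le[OF Suc.prems] by simp
  \<comment> \<open>The coefficients of the top level combine since \<open>k * (k + 2) + 1\<close>
    is the square of \<open>k + 1\<close>.\<close>
  finally have "real (Suc k) * ?E (Suc k) \<le> real (Suc k) * (real (Suc k) * ?E (Suc (Suc k)) + ?E 0)"
    by (simp add: algebra_simps)
  then show ?case by (subst (asm) mult_le_cancel_left_pos) auto
qed

subsection \<open>The down-up walk\<close>

locale weighted_ksubsets =
  fixes n k :: nat and \<mu> :: "nat set \<Rightarrow> real"
  assumes k_pos: "1 \<le> k"
    and nonneg: "S \<in> ksubsets n k \<Longrightarrow> 0 \<le> \<mu> S"
    and mass_pos: "0 < upmass n k \<mu> {}"
begin

abbreviation "M \<equiv> upmass n k \<mu> {}"
abbreviation "P \<equiv> down_up_walk n k \<mu>"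
abbreviation "up \<equiv> up_step n k \<mu>"

text \<open>One step of the walk on weights of any total mass; the warm start splits a distribution
  into two parts that are followed separately.\<close>

definition push :: "(nat set \<Rightarrow> real) \<Rightarrow> nat set \<Rightarrow> real" where
  "push \<nu> S' = (\<Sum>S\<in>ksubsets n k. \<nu> S * P S S')"

text \<open>For total mass \<open>N > 0\<close> of \<open>\<nu>\<close>, this is \<open>N\<close>
  times the relative entropy of the normalised weights.\<close>

definition excess :: "(nat set \<Rightarrow> real) \<Rightarrow> real" where
  "excess \<nu> = entropy n k \<nu> \<mu> k - entropy n k \<nu> \<mu> 0"

lemma upmass_mu_nonneg: "0 \<le> upmass n k \<mu> T"
  using nonneg by (rule upmass_nonneg)

lemma up_eq: "S' \<in> ksubsets n k \<Longrightarrow> up T S' = (if T \<subseteq> S' then \<mu> S' / upmass n k \<mu> T else 0)"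
  by (simp add: up_step_def upmass_def)

lemma up_nonneg: "S' \<in> ksubsets n k \<Longrightarrow> 0 \<le> up T S'"
  by (simp add: up_eq nonneg upmass_mu_nonneg)

lemma sum_up: "(\<Sum>S'\<in>ksubsets n k. up T S') = (if upmass n k \<mu> T = 0 then 0 else 1)"
proof -
  have "(\<Sum>S'\<in>ksubsets n k. up T S') =
        (\<Sum>S'\<in>ksubsets n k. (if T \<subseteq> S' then \<mu> S' else 0) / upmass n k \<mu> T)"
    by (intro sum.cong) (auto simp: up_eq)
  then show ?thesis
    by (simp add: upmass_eq_sum_if flip: sum_divide_distrib)
qed

lemma card_facets:
  assumes "S \<in> ksubsets n k"
  shows "card {T \<in> ksubsets n (k - 1). T \<subseteq> S} = k" "card {T. T \<subseteq> S \<and> card T = k - 1} = k"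
proof -
  show "card {T. T \<subseteq> S \<and> card T = k - 1} = k"
    using n_subsets[OF ksubsetsD(2)[OF assms], of "k - 1"] ksubsetsD(3)[OF assms] k_pos
      binomial_symmetric[of 1 k] by simp
  moreover have "{T \<in> ksubsets n (k - 1). T \<subseteq> S} = {T. T \<subseteq> S \<and> card T = k - 1}"
    using assms by (auto simp: ksubsets_def)
  ultimately show "card {T \<in> ksubsets n (k - 1). T \<subseteq> S} = k" by simp
qed

lemma down_step_eq:
  assumes "S \<in> ksubsets n k" "T \<in> ksubsets n (k - 1)"
  shows "down_step k S T = (if T \<subseteq> S then 1 / real k else 0)"
  unfolding down_step_def card_facets(2)[OF assms(1)] using ksubsetsD(3)[OF assms(2)] by simp

lemma walk_nonneg: "S \<in> ksubsets n k \<Longrightarrow> S' \<in> ksubsets n k \<Longrightarrow> 0 \<le> P S S'"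
  unfolding down_up_walk_def by (intro sum_nonneg mult_nonneg_nonneg up_nonneg) (auto simp: down_step_eq)

text \<open>The facets of \<open>S\<close> are the sets \<open>S - {e}\<close>. Indexing the
  down-step by the dropped element makes it possible to record which elements were dropped.\<close>

lemma walk_eq:
  assumes "S \<in> ksubsets n k" "S' \<in> ksubsets n k"
  shows "P S S' = (\<Sum>e\<in>S. up (S - {e}) S' / real k)"
proof -
  have inj: "inj_on (\<lambda>e. S - {e}) S" by (auto simp: inj_on_def)
  have "P S S' = (\<Sum>T\<in>ksubsets n (k - 1). if T \<subseteq> S then up T S' / real k else 0)"
    unfolding down_up_walk_def using assms by (intro sum.cong) (auto simp: down_step_eq)
  also have "\<dots> = (\<Sum>T\<in>{T \<in> ksubsets n (k - 1). T \<subseteq> S}. up T S' / real k)"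
    by (simp add: sum.inter_filter)
  also have "{T \<in> ksubsets n (k - 1). T \<subseteq> S} = (\<lambda>e. S - {e}) ` S"
  proof (intro equalityI subsetI)
    fix T assume T: "T \<in> {T \<in> ksubsets n (k - 1). T \<subseteq> S}"
    then have "card (S - T) = 1"
      using ksubsetsD[OF assms(1)] ksubsetsD(2,3)[of T n "k - 1"] k_pos by (simp add: card_Diff_subset)
    then obtain e where "S - T = {e}" by (auto simp: card_1_singleton_iff)
    with T have "e \<in> S" "T = S - {e}" by auto
    then show "T \<in> (\<lambda>e. S - {e}) ` S" by blast
  qed (use assms(1) k_pos remove_in_ksubsets[of S n "k - 1"] in auto)
  also have "(\<Sum>T\<in>(\<lambda>e. S - {e}) ` S. up T S' / real k) = (\<Sum>e\<in>S. up (S - {e}) S' / real k)"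
    by (simp add: sum.reindex[OF inj])
  finally show ?thesis .
qed

lemma push_eq:
  assumes "S' \<in> ksubsets n k"
  shows "push \<nu> S' = (\<Sum>T\<in>ksubsets n (k - 1). upmass n k \<nu> T / real k * up T S')"
proof -
  have "push \<nu> S' = (\<Sum>S\<in>ksubsets n k. \<Sum>T\<in>ksubsets n (k - 1). \<nu> S * down_step k S T * up T S')"
    by (simp add: push_def down_up_walk_def sum_distrib_left mult.assoc)
  also have "\<dots> = (\<Sum>T\<in>ksubsets n (k - 1). \<Sum>S\<in>ksubsets n k. \<nu> S * down_step k S T * up T S')"
    by (rule sum.swap)
  also have "\<dots> = (\<Sum>T\<in>ksubsets n (k - 1). upmass n k \<nu> T / real k * up T S')"
    unfolding upmass_eq_sum_if sum_divide_distrib sum_distrib_right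
    by (intro sum.cong refl) (auto simp: down_step_eq)
  finally show ?thesis .
qed

lemma sum_push:
  assumes "dominated n k \<nu> \<mu>"
  shows "(\<Sum>S\<in>ksubsets n k. push \<nu> S) = (\<Sum>S\<in>ksubsets n k. \<nu> S)"
proof -
  have "(\<Sum>S'\<in>ksubsets n k. push \<nu> S') =
        (\<Sum>S'\<in>ksubsets n k. \<Sum>T\<in>ksubsets n (k - 1). upmass n k \<nu> T / real k * up T S')"
    by (intro sum.cong refl push_eq)
  also have "\<dots> = (\<Sum>T\<in>ksubsets n (k - 1). \<Sum>S'\<in>ksubsets n k. upmass n k \<nu> T / real k * up T S')"
    by (rule sum.swap)
  \<comment> \<open>The up-step loses all mass at sets \<open>T\<close> of weight 0, but by
    domination \<open>\<nu>\<close> puts none there.\<close>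
  also have "\<dots> = (\<Sum>T\<in>ksubsets n (k - 1). upmass n k \<nu> T / real k)"
    unfolding sum_distrib_left [symmetric] sum_up
    using dominated_upmass_0[OF assms] by (intro sum.cong refl) auto
  also have "\<dots> = (\<Sum>T\<in>ksubsets n (k - 1). \<Sum>S\<in>ksubsets n k. \<nu> S * down_step k S T)"
    unfolding upmass_eq_sum_if sum_divide_distrib
    by (intro sum.cong refl) (auto simp: down_step_eq)
  also have "\<dots> = (\<Sum>S\<in>ksubsets n k. \<Sum>T\<in>ksubsets n (k - 1). \<nu> S * down_step k S T)"
    by (rule sum.swap)
  also have "\<dots> = (\<Sum>S\<in>ksubsets n k. \<nu> S)"
  proof (intro sum.cong refl)
    fix S assume S: "S \<in> ksubsets n k"
    have "(\<Sum>T\<in>ksubsets n (k - 1). \<nu> S * down_step k S T) =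
        (\<Sum>T\<in>{T \<in> ksubsets n (k - 1). T \<subseteq> S}. \<nu> S / real k)"
      unfolding sum.inter_filter[OF finite_ksubsets]
      using S by (intro sum.cong refl) (auto simp: down_step_eq)
    also have "\<dots> = real (card {T \<in> ksubsets n (k - 1). T \<subseteq> S}) * (\<nu> S / real k)"
      by simp
    finally show "(\<Sum>T\<in>ksubsets n (k - 1). \<nu> S * down_step k S T) = \<nu> S"
      unfolding card_facets(1)[OF S] using k_pos by simp
  qed
  finally show ?thesis .
qed

lemma dominated_push:
  assumes "dominated n k \<nu> \<mu>"
  shows "dominated n k (push \<nu>) \<mu>"
  unfolding dominated_def
proof (intro ballI conjI impI)
  fix S assume S: "S \<in> ksubsets n k"
  show "0 \<le> \<mu> S" using S by (rule nonneg)
  show "0 \<le> push \<nu> S"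
    unfolding push_def using S by (intro sum_nonneg mult_nonneg_nonneg walk_nonneg dominatedD[OF assms])
  assume "\<mu> S = 0"
  then show "push \<nu> S = 0"
    using S by (auto simp: push_eq up_eq intro!: sum.neutral)
qed

section \<open>Contraction of relative entropy under the walk\<close>

text \<open>Convexity of \<open>x * ln x\<close>: the left-hand side is its tangent at
  \<open>y\<close>.\<close>

lemma xlnx_ge_tangent:
  fixes x y :: real
  assumes "0 \<le> x" "0 < y"
  shows "x * ln y + x - y \<le> x * ln x"
proof (cases "x = 0")
  case False
  then have "x * ln (y / x) \<le> x * (y / x - 1)"
    using assms by (intro mult_left_mono ln_le_minus_one) auto
  then show ?thesis using False assms by (simp add: ln_div algebra_simps)
qed (use assms in auto)

text \<open>Jensen's inequality for \<open>x ln x\<close>: the density of \<open>push \<nu>\<close> at \<open>S'\<close> is the average of the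
  densities of \<open>\<nu>\<close> at the \<open>k\<close> facets of \<open>S'\<close>.\<close>

lemma entropy_push_le:
  assumes dom: "dominated n k \<nu> \<mu>"
  shows "entropy n k (push \<nu>) \<mu> k \<le> entropy n k \<nu> \<mu> (k - 1) / real k"
proof -
  define r where "r = (\<lambda>T. upmass n k \<nu> T / upmass n k \<mu> T)"
  have r0: "0 \<le> r T" for T
    unfolding r_def using dom by (auto intro!: divide_nonneg_nonneg upmass_nonneg dest: dominatedD)
  have pointwise: "push \<nu> S * ln (push \<nu> S / \<mu> S) \<le>
      (\<Sum>T\<in>ksubsets n (k - 1). if T \<subseteq> S then \<mu> S / real k * (r T * ln (r T)) else 0)"
    if S: "S \<in> ksubsets n k" for S
  proof (cases "\<mu> S = 0")
    case True
    then show ?thesis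
      using dominatedD(3)[OF dominated_push[OF dom] S] by (auto intro!: sum_nonneg)
  next
    case False
    define F where "F = {T \<in> ksubsets n (k - 1). T \<subseteq> S}"
    have F: "finite F" "card F = k"
      using card_facets(1)[OF S] by (simp_all add: F_def)
    have pos: "\<mu> S > 0" using False nonneg[OF S] by simp
    define y where "y = push \<nu> S / \<mu> S"
    have "push \<nu> S = (\<Sum>T\<in>F. \<mu> S / real k * r T)"
      unfolding push_eq[OF S] F_def sum.inter_filter[OF finite_ksubsets]
      using S by (intro sum.cong refl) (auto simp: up_eq r_def mult_ac)
    then have "push \<nu> S = \<mu> S / real k * (\<Sum>T\<in>F. r T)"
      by (simp only: sum_distrib_left)
    then have y: "(\<Sum>T\<in>F. r T) = real k * y"
      using pos k_pos by (simp add: y_def)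
    then have y0: "0 \<le> y"
      using sum_nonneg[of F r] r0 k_pos by (simp add: zero_le_mult_iff)
    have "real k * (y * ln y) \<le> (\<Sum>T\<in>F. r T * ln (r T))"
    \<comment> \<open>The tangent is taken at the mean \<open>y\<close>, which has to be positive;
      the terms \<open>r T - y\<close> sum to 0.\<close>
    proof (cases "y = 0")
      case True
      then have "\<forall>T\<in>F. r T = 0"
        using y F r0 by (simp add: sum_nonneg_eq_0_iff)
      with True show ?thesis by simp
    next
      case False
      with y0 have "y > 0" by simp
      have "real k * (y * ln y) = (\<Sum>T\<in>F. r T * ln y + r T - y)"
        using F by (simp add: sum.distrib sum_subtractf y flip: sum_distrib_right)
      also have "\<dots> \<le> (\<Sum>T\<in>F. r T * ln (r T))"
        using r0 \<open>y > 0\<close> by (intro sum_mono xlnx_ge_tangent)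
      finally show ?thesis .
    qed
    then have "\<mu> S / real k * (real k * (y * ln y)) \<le> \<mu> S / real k * (\<Sum>T\<in>F. r T * ln (r T))"
      using pos by (intro mult_left_mono) auto
    moreover have "\<mu> S / real k * (real k * (y * ln y)) = push \<nu> S * ln (push \<nu> S / \<mu> S)"
      using k_pos pos by (simp add: y_def)
    moreover have "\<mu> S / real k * (\<Sum>T\<in>F. r T * ln (r T)) =
        (\<Sum>T\<in>ksubsets n (k - 1). if T \<subseteq> S then \<mu> S / real k * (r T * ln (r T)) else 0)"
      unfolding sum_distrib_left F_def by (rule sum.inter_filter) simp
    ultimately show ?thesis by simp
  qed
  have "entropy n k (push \<nu>) \<mu> k \<le>
      (\<Sum>S\<in>ksubsets n k. \<Sum>T\<in>ksubsets n (k - 1). if T \<subseteq> S then \<mu> S / real k * (r T * ln (r T)) else 0)"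
    unfolding entropy_top by (intro sum_mono pointwise)
  also have "\<dots> = (\<Sum>T\<in>ksubsets n (k - 1). \<Sum>S\<in>ksubsets n k. if T \<subseteq> S then \<mu> S / real k * (r T * ln (r T)) else 0)"
    by (rule sum.swap)
  also have "\<dots> = (\<Sum>T\<in>ksubsets n (k - 1). upmass n k \<mu> T * (r T * ln (r T)) / real k)"
    unfolding upmass_eq_sum_if[of n k \<mu>] sum_distrib_right sum_divide_distrib
    by (intro sum.cong refl) auto
  also have "\<dots> = entropy n k \<nu> \<mu> (k - 1) / real k"
    unfolding entropy_def sum_divide_distrib
    using dominated_upmass_0[OF dom] by (intro sum.cong refl) (auto simp: r_def)
  finally show ?thesis .
qed

text \<open>Jensen's inequality bounds the new entropy by level \<open>k - 1\<close> of the old one,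
  and entropy contraction leads back to level \<open>k\<close>. Level 0 is unchanged because a step
  preserves the total mass.\<close>

lemma excess_push_le:
  assumes lc: "log_concave n (gen_poly n k \<mu>)" and dom: "dominated n k \<nu> \<mu>"
  shows "excess (push \<nu>) \<le> (1 - 1 / real k) * excess \<nu>"
proof -
  have "entropy n k \<nu> \<mu> (k - 1) \<le> real (k - 1) * entropy n k \<nu> \<mu> k + entropy n k \<nu> \<mu> 0"
    using entropy_contraction[of n "k - 1" \<mu> \<nu>] lc dom k_pos by simp
  then have "entropy n k \<nu> \<mu> (k - 1) / real k \<le>
      (real (k - 1) * entropy n k \<nu> \<mu> k + entropy n k \<nu> \<mu> 0) / real k"
    by (rule divide_right_mono) simp
  moreover have "entropy n k (push \<nu>) \<mu> 0 = entropy n k \<nu> \<mu> 0"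
    by (simp add: entropy_0 upmass_empty sum_push[OF dom])
  moreover have "(real (k - 1) * entropy n k \<nu> \<mu> k + entropy n k \<nu> \<mu> 0) / real k - entropy n k \<nu> \<mu> 0
      = (1 - 1 / real k) * excess \<nu>"
    using k_pos by (simp add: excess_def of_nat_diff field_simps)
  ultimately show ?thesis
    using entropy_push_le[OF dom] unfolding excess_def by linarith
qed

section \<open>Iterated steps and total variation distance\<close>

lemma push_iter:
  assumes dom: "dominated n k \<nu> \<mu>"
  shows "dominated n k ((push ^^ t) \<nu>) \<mu>"
    "(\<Sum>S\<in>ksubsets n k. (push ^^ t) \<nu> S) = (\<Sum>S\<in>ksubsets n k. \<nu> S)"
  by (induction t) (use dom in \<open>auto simp: dominated_push sum_push\<close>)

lemma excess_iter_le:
  assumes lc: "log_concave n (gen_poly n k \<mu>)" and dom: "dominated n k \<nu> \<mu>"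
  shows "excess ((push ^^ t) \<nu>) \<le> (1 - 1 / real k) ^ t * excess \<nu>"
proof (induction t)
  case (Suc t)
  have "excess ((push ^^ Suc t) \<nu>) \<le> (1 - 1 / real k) * excess ((push ^^ t) \<nu>)"
    using excess_push_le[OF lc push_iter(1)[OF dom]] by simp
  also have "\<dots> \<le> (1 - 1 / real k) * ((1 - 1 / real k) ^ t * excess \<nu>)"
    using k_pos by (intro mult_left_mono Suc) simp
  finally show ?case by simp
qed simp

lemma push_iter_add:
  "(push ^^ t) (\<lambda>S. a S + b S) = (\<lambda>S. (push ^^ t) a S + (push ^^ t) b S)"
  by (induction t) (auto simp: push_def distrib_right sum.distrib)

lemma push_iter_cong:
  assumes "\<And>S. S \<in> ksubsets n k \<Longrightarrow> a S = b S" "S \<in> ksubsets n k"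
  shows "(push ^^ t) a S = (push ^^ t) b S"
  using assms by (induction t arbitrary: S) (auto simp: push_def)

lemma kernel_power_add:
  assumes "S \<in> ksubsets n k"
  shows "kernel_power (ksubsets n k) P (s + t) S0 S = (push ^^ t) (kernel_power (ksubsets n k) P s S0) S"
  using assms by (induction t arbitrary: S) (auto simp: push_def)

text \<open>A form of Pinsker's inequality, obtained from the Hellinger distance by Cauchy-Schwarz.\<close>

lemma hellinger_le:
  fixes p q :: real
  assumes "0 \<le> p" "0 < q"
  shows "(sqrt p - sqrt q)\<^sup>2 \<le> p * ln (p / q) - p + q"
proof (cases "p = 0")
  case False
  then have p: "p > 0" using assms by simp
  \<comment> \<open>The square root turns \<open>ln (p / q)\<close> into \<open>- 2 * ln x\<close>,
    so that \<open>ln x \<le> x - 1\<close> yields the mixed term of the square.\<close>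
  define x where "x = sqrt (q / p)"
  have x: "x > 0" "x\<^sup>2 = q / p" using p assms by (auto simp: x_def)
  have "ln (p / q) = - ln (x\<^sup>2)" using p assms by (simp add: x ln_div)
  also have "\<dots> = - (2 * ln x)" using x(1) by (subst ln_realpow) auto
  finally have "p * ln (p / q) \<ge> p * (- (2 * (x - 1)))"
    using p ln_le_minus_one[OF x(1)] by (intro mult_left_mono) auto
  moreover have "p * x = sqrt p * sqrt q"
    using p assms by (simp add: x_def real_sqrt_divide field_simps)
  ultimately show ?thesis
    using p assms by (simp add: power2_diff algebra_simps)
qed (use assms in auto)

text \<open>Cauchy-Schwarz leaves the squared Hellinger distance, which is at most the excess, and a
  second factor of at most \<open>4 * N\<close>. The mass \<open>N\<close> is arbitrary so that the
  bound applies to the warm part of the law alone.\<close>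

lemma l1_dist_le:
  assumes dom: "dominated n k \<nu> \<mu>" and N: "N = (\<Sum>S\<in>ksubsets n k. \<nu> S)"
  shows "(\<Sum>S\<in>ksubsets n k. \<bar>\<nu> S - N * normalized n k \<mu> S\<bar>)\<^sup>2 \<le> 4 * N * excess \<nu>"
proof -
  define q where "q = (\<lambda>S. N * normalized n k \<mu> S)"
  note domD = dominatedD[OF dom]
  have N0: "0 \<le> N" unfolding N by (intro sum_nonneg domD(2))
  have q0: "0 \<le> q S" if "S \<in> ksubsets n k" for S
    using that N0 mass_pos nonneg by (simp add: q_def normalized_def flip: upmass_empty)
  have sumq: "(\<Sum>S\<in>ksubsets n k. q S) = N"
    using mass_pos by (simp add: q_def normalized_def upmass_empty flip: sum_distrib_left sum_divide_distrib)
  have H: "(sqrt (\<nu> S) - sqrt (q S))\<^sup>2 \<le> \<nu> S * ln (\<nu> S / \<mu> S) - \<nu> S * ln (N / M) - \<nu> S + q S"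
    if S: "S \<in> ksubsets n k" for S
  proof (cases "\<nu> S = 0")
    case True
    then show ?thesis using q0[OF S] by simp
  next
    case False
    then have "\<nu> S > 0" "\<mu> S > 0" using domD[OF S] by (auto simp: order_less_le)
    moreover have "\<nu> S \<le> N" unfolding N using S domD(2) by (intro member_le_sum) auto
    ultimately have "N > 0" by simp
    have "q S = \<mu> S * (N / M)" by (simp add: q_def normalized_def upmass_empty)
    moreover from this have "ln (\<nu> S / q S) = ln (\<nu> S / \<mu> S) - ln (N / M)"
      using \<open>N > 0\<close> \<open>\<nu> S > 0\<close> \<open>\<mu> S > 0\<close> mass_pos by (simp add: ln_div ln_mult)
    moreover have "q S > 0" using calculation(1) \<open>N > 0\<close> \<open>\<mu> S > 0\<close> mass_pos by simp
    ultimately show ?thesis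
      using hellinger_le[of "\<nu> S" "q S"] \<open>\<nu> S > 0\<close> by (simp add: right_diff_distrib)
  qed
  have "(\<Sum>S\<in>ksubsets n k. \<bar>\<nu> S - q S\<bar>) =
      (\<Sum>S\<in>ksubsets n k. \<bar>sqrt (\<nu> S) - sqrt (q S)\<bar> * (sqrt (\<nu> S) + sqrt (q S)))"
  proof (intro sum.cong refl)
    fix S assume S: "S \<in> ksubsets n k"
    have "\<nu> S - q S = (sqrt (\<nu> S) - sqrt (q S)) * (sqrt (\<nu> S) + sqrt (q S))"
      using q0[OF S] domD(2)[OF S] by (simp add: algebra_simps)
    then have "\<bar>\<nu> S - q S\<bar> = \<bar>sqrt (\<nu> S) - sqrt (q S)\<bar> * \<bar>sqrt (\<nu> S) + sqrt (q S)\<bar>"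
      by (simp only: abs_mult)
    then show "\<bar>\<nu> S - q S\<bar> = \<bar>sqrt (\<nu> S) - sqrt (q S)\<bar> * (sqrt (\<nu> S) + sqrt (q S))"
      using q0[OF S] domD(2)[OF S] by simp
  qed
  then have "(\<Sum>S\<in>ksubsets n k. \<bar>\<nu> S - q S\<bar>)\<^sup>2 \<le>
      (\<Sum>S\<in>ksubsets n k. \<bar>sqrt (\<nu> S) - sqrt (q S)\<bar>\<^sup>2) * (\<Sum>S\<in>ksubsets n k. (sqrt (\<nu> S) + sqrt (q S))\<^sup>2)"
    using Cauchy_Schwarz_ineq_sum[of "\<lambda>S. \<bar>sqrt (\<nu> S) - sqrt (q S)\<bar>"] by simp
  also have "\<dots> \<le> excess \<nu> * (4 * N)"
  proof (intro mult_mono sum_nonneg)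
    have "(\<Sum>S\<in>ksubsets n k. \<bar>sqrt (\<nu> S) - sqrt (q S)\<bar>\<^sup>2) \<le>
        (\<Sum>S\<in>ksubsets n k. \<nu> S * ln (\<nu> S / \<mu> S) - \<nu> S * ln (N / M) - \<nu> S + q S)"
      using H by (intro sum_mono) simp
    also have "\<dots> = excess \<nu>"
      by (simp add: sum.distrib sum_subtractf sumq excess_def entropy_top entropy_0
          upmass_empty[of n k \<nu>] flip: N sum_distrib_right)
    finally show *: "(\<Sum>S\<in>ksubsets n k. \<bar>sqrt (\<nu> S) - sqrt (q S)\<bar>\<^sup>2) \<le> excess \<nu>" .
    show "0 \<le> excess \<nu>" by (rule order_trans[OF _ *]) (simp add: sum_nonneg)
    have "(sqrt (\<nu> S) + sqrt (q S))\<^sup>2 \<le> 2 * \<nu> S + 2 * q S" if S: "S \<in> ksubsets n k" for S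
      using q0[OF S] domD(2)[OF S] sum_squares_bound[of "sqrt (\<nu> S)" "sqrt (q S)"]
      by (simp add: power2_sum)
    then have "(\<Sum>S\<in>ksubsets n k. (sqrt (\<nu> S) + sqrt (q S))\<^sup>2) \<le> (\<Sum>S\<in>ksubsets n k. 2 * \<nu> S + 2 * q S)"
      by (rule sum_mono)
    also have "\<dots> = 4 * N" by (simp add: sum.distrib sumq N flip: sum_distrib_left)
    finally show "(\<Sum>S\<in>ksubsets n k. (sqrt (\<nu> S) + sqrt (q S))\<^sup>2) \<le> 4 * N" .
  qed simp
  finally show ?thesis by (simp add: q_def mult.commute)
qed

subsection \<open>Warm start\<close>

text \<open>Loss per step: 2 for the possible records before the step, \<open>k\<close> for the
  facets of the new set, \<open>2 ^ k\<close> for removing the surviving elements from the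
  condition.\<close>

definition growth :: real where
  "growth = 2 * real k * 2 ^ k"

text \<open>\<open>track S0 t U S\<close> is the probability that after \<open>t\<close> steps from \<open>S0\<close> the walk is at \<open>S\<close> and
  \<open>U\<close> is the set of elements of \<open>S0\<close> that were never dropped.\<close>

fun track :: "nat set \<Rightarrow> nat \<Rightarrow> nat set \<Rightarrow> nat set \<Rightarrow> real" where
  "track S0 0 U S = (if U = S0 \<and> S = S0 then 1 else 0)"
| "track S0 (Suc t) U S' = (\<Sum>S\<in>ksubsets n k. \<Sum>e\<in>S. \<Sum>V\<in>{V \<in> Pow S0. V - {e} = U}.
     track S0 t V S / real k * up (S - {e}) S')"

context
  fixes S0 assumes S0: "S0 \<in> ksubsets n k"
begin

lemma track_nonneg: "S \<in> ksubsets n k \<Longrightarrow> 0 \<le> track S0 t U S"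
  by (induction t arbitrary: U S)
     (auto intro!: sum_nonneg divide_nonneg_nonneg mult_nonneg_nonneg up_nonneg)

text \<open>If a record \<open>V\<close> lies in \<open>R\<close>, then \<open>V - {e}\<close> lies
  in the facet \<open>R - {e}\<close>, which every successor contains.\<close>

lemma track_support:
  assumes "S \<in> ksubsets n k" "\<not> U \<subseteq> S"
  shows "track S0 t U S = 0"
  using assms
proof (induction t arbitrary: U S)
  case (Suc t)
  have "track S0 t V R / real k * up (R - {e}) S = 0"
    if "R \<in> ksubsets n k" "V - {e} = U" for R e V
  proof (cases "V \<subseteq> R")
    case True
    with that Suc.prems have "\<not> R - {e} \<subseteq> S" by auto
    then show ?thesis by (simp add: up_eq Suc.prems)
  qed (use Suc.IH that in auto)
  then show ?case by (auto intro!: sum.neutral)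
qed auto

text \<open>Dropping \<open>e\<close> turns each old record \<open>V\<close> into exactly one new
  record \<open>V - {e}\<close>, so a sum over new records regroups into one over old
  records.\<close>

lemma sum_track_Suc:
  "(\<Sum>U\<in>Pow S0. w U * track S0 (Suc t) U S') =
   (\<Sum>S\<in>ksubsets n k. \<Sum>e\<in>S. \<Sum>V\<in>Pow S0. w (V - {e}) * (track S0 t V S / real k * up (S - {e}) S'))"
proof -
  have fin: "finite (Pow S0)" using ksubsetsD(2)[OF S0] by simp
  let ?f = "\<lambda>S e V. track S0 t V S / real k * up (S - {e}) S'"
  have "(\<Sum>U\<in>Pow S0. w U * track S0 (Suc t) U S') =
      (\<Sum>U\<in>Pow S0. \<Sum>S\<in>ksubsets n k. \<Sum>e\<in>S. \<Sum>V\<in>{V \<in> Pow S0. V - {e} = U}. w (V - {e}) * ?f S e V)"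
    by (auto simp: sum_distrib_left intro!: sum.cong)
  also have "\<dots> = (\<Sum>S\<in>ksubsets n k. \<Sum>U\<in>Pow S0. \<Sum>e\<in>S. \<Sum>V\<in>{V \<in> Pow S0. V - {e} = U}. w (V - {e}) * ?f S e V)"
    by (rule sum.swap)
  also have "\<dots> = (\<Sum>S\<in>ksubsets n k. \<Sum>e\<in>S. \<Sum>U\<in>Pow S0. \<Sum>V\<in>{V \<in> Pow S0. V - {e} = U}. w (V - {e}) * ?f S e V)"
    by (intro sum.cong refl sum.swap)
  also have "\<dots> = (\<Sum>S\<in>ksubsets n k. \<Sum>e\<in>S. \<Sum>V\<in>Pow S0. w (V - {e}) * ?f S e V)"
    by (intro sum.cong refl sum.group fin) auto
  finally show ?thesis .
qed

lemma sum_track: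
  assumes "S \<in> ksubsets n k"
  shows "(\<Sum>U\<in>Pow S0. track S0 t U S) = kernel_power (ksubsets n k) P t S0 S"
  using assms
proof (induction t arbitrary: S)
  case 0
  have "(\<Sum>U\<in>Pow S0. track S0 0 U S) = (\<Sum>U\<in>Pow S0. if U = S0 then (if S = S0 then 1 else 0) else 0)"
    by (intro sum.cong) auto
  then show ?case
    using ksubsetsD(2)[OF S0] by (auto simp: sum.delta)
next
  case (Suc t S')
  have "(\<Sum>U\<in>Pow S0. track S0 (Suc t) U S') =
      (\<Sum>S\<in>ksubsets n k. \<Sum>e\<in>S. \<Sum>V\<in>Pow S0. track S0 t V S / real k * up (S - {e}) S')"
    using sum_track_Suc[of "\<lambda>_. 1" t S'] by simp
  also have "\<dots> = (\<Sum>S\<in>ksubsets n k. (\<Sum>V\<in>Pow S0. track S0 t V S) * P S S')"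
  proof (intro sum.cong refl)
    fix S assume "S \<in> ksubsets n k"
    then show "(\<Sum>e\<in>S. \<Sum>V\<in>Pow S0. track S0 t V S / real k * up (S - {e}) S') =
        (\<Sum>V\<in>Pow S0. track S0 t V S) * P S S'"
      using Suc.prems by (subst sum.swap) (simp add: walk_eq sum_product)
  qed
  also have "\<dots> = kernel_power (ksubsets n k) P (Suc t) S0 S'"
    using Suc.IH by simp
  finally show ?case .
qed

text \<open>A surviving element is one of the \<open>k\<close> elements of the current set, and the
  dropped one is chosen uniformly among them.\<close>

lemma track_survival:
  assumes i: "i \<in> S0"
  shows "(\<Sum>S\<in>ksubsets n k. \<Sum>U\<in>Pow S0. (if i \<in> U then 1 else 0) * track S0 t U S) \<le> (1 - 1 / real k) ^ t"
proof (induction t)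
  case 0
  have "(\<Sum>S\<in>ksubsets n k. \<Sum>U\<in>Pow S0. (if i \<in> U then 1 else 0) * track S0 0 U S) =
      (\<Sum>S\<in>ksubsets n k. if S = S0 then 1 else 0)"
  proof (intro sum.cong refl)
    fix S
    have "(\<Sum>U\<in>Pow S0. (if i \<in> U then 1 else 0) * track S0 0 U S) =
        (\<Sum>U\<in>Pow S0. if U = S0 then (if S = S0 then 1 else 0) else 0)"
      using i by (intro sum.cong) auto
    then show "(\<Sum>U\<in>Pow S0. (if i \<in> U then 1 else 0) * track S0 0 U S) = (if S = S0 then 1 else 0)"
      using ksubsetsD(2)[OF S0] by simp
  qed
  then show ?case using S0 by simp
next
  case (Suc t)
  define w where "w = (\<lambda>U. if i \<in> U then 1 else (0::real))"
  have w: "0 \<le> w U" for U by (simp add: w_def)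
  have "(\<Sum>S'\<in>ksubsets n k. \<Sum>U\<in>Pow S0. w U * track S0 (Suc t) U S') =
      (\<Sum>S'\<in>ksubsets n k. \<Sum>S\<in>ksubsets n k. \<Sum>e\<in>S. \<Sum>V\<in>Pow S0.
         w (V - {e}) * (track S0 t V S / real k * up (S - {e}) S'))"
    by (intro sum.cong refl sum_track_Suc)
  also have "\<dots> = (\<Sum>S\<in>ksubsets n k. \<Sum>S'\<in>ksubsets n k. \<Sum>e\<in>S. \<Sum>V\<in>Pow S0.
         w (V - {e}) * (track S0 t V S / real k * up (S - {e}) S'))"
    by (rule sum.swap)
  also have "\<dots> = (\<Sum>S\<in>ksubsets n k. \<Sum>e\<in>S. \<Sum>V\<in>Pow S0. \<Sum>S'\<in>ksubsets n k.
         w (V - {e}) * (track S0 t V S / real k * up (S - {e}) S'))"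
    by (simp only: sum.swap[of _ _ "ksubsets n k"])
  also have "\<dots> \<le> (\<Sum>S\<in>ksubsets n k. \<Sum>e\<in>S. \<Sum>V\<in>Pow S0. w (V - {e}) * (track S0 t V S / real k))"
  proof (intro sum_mono)
    fix S e V assume S: "S \<in> ksubsets n k"
    have "(\<Sum>S'\<in>ksubsets n k. w (V - {e}) * (track S0 t V S / real k * up (S - {e}) S')) =
        w (V - {e}) * (track S0 t V S / real k) * (\<Sum>S'\<in>ksubsets n k. up (S - {e}) S')"
      by (simp add: sum_distrib_left mult.assoc)
    also have "\<dots> \<le> w (V - {e}) * (track S0 t V S / real k) * 1"
      using w track_nonneg[OF S] by (intro mult_left_mono) (auto simp: sum_up)
    finally show "(\<Sum>S'\<in>ksubsets n k. w (V - {e}) * (track S0 t V S / real k * up (S - {e}) S')) \<le>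
        w (V - {e}) * (track S0 t V S / real k)" by simp
  qed
  also have "\<dots> = (\<Sum>S\<in>ksubsets n k. \<Sum>V\<in>Pow S0. \<Sum>e\<in>S. w (V - {e}) * (track S0 t V S / real k))"
    by (intro sum.cong refl sum.swap)
  also have "\<dots> = (\<Sum>S\<in>ksubsets n k. \<Sum>V\<in>Pow S0. (1 - 1 / real k) * (w V * track S0 t V S))"
  proof (intro sum.cong refl)
    fix S V assume S: "S \<in> ksubsets n k"
    show "(\<Sum>e\<in>S. w (V - {e}) * (track S0 t V S / real k)) = (1 - 1 / real k) * (w V * track S0 t V S)"
    \<comment> \<open>Only \<open>e = i\<close> removes \<open>i\<close> from the record; records
      not contained in \<open>S\<close> have weight 0.\<close>
    proof (cases "V \<subseteq> S \<and> i \<in> V")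
      case True
      then have "(\<Sum>e\<in>S. w (V - {e})) = (\<Sum>e\<in>S. if e = i then 0 else 1)"
        by (intro sum.cong) (auto simp: w_def)
      also have "\<dots> = (\<Sum>e\<in>S - {i}. 1)"
        using ksubsetsD(2)[OF S] by (intro sum.mono_neutral_cong_right) auto
      also have "\<dots> = real k - 1"
        using True k_pos ksubsetsD(2,3)[OF S] by (simp add: of_nat_diff subset_iff)
      finally have "(\<Sum>e\<in>S. w (V - {e}) * (track S0 t V S / real k)) =
          (real k - 1) * (track S0 t V S / real k)"
        by (simp only: flip: sum_distrib_right)
      then show ?thesis using True k_pos by (simp add: w_def field_simps)
    next
      case False
      then have "w (V - {e}) * track S0 t V S = 0" "w V * track S0 t V S = 0" for e
        using track_support[OF S, of V t] by (auto simp: w_def)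
      then show ?thesis by (simp only: times_divide_eq_right) simp
    qed
  qed
  also have "\<dots> = (1 - 1 / real k) * (\<Sum>S\<in>ksubsets n k. \<Sum>V\<in>Pow S0. w V * track S0 t V S)"
    by (simp add: sum_distrib_left)
  also have "\<dots> \<le> (1 - 1 / real k) * (1 - 1 / real k) ^ t"
    using Suc.IH k_pos by (intro mult_left_mono) (auto simp: w_def)
  finally show ?case by (simp add: w_def)
qed

context
  assumes lc: "log_concave n (gen_poly n k \<mu>)"
begin

text \<open>The up-step adds the single element of \<open>S - T\<close>, with its conditional
  probability given \<open>T\<close>. Removing \<open>U\<close> from the condition costs at most
  \<open>2 ^ card U\<close>, by the iterated correlation bound with
  \<open>B = T - U\<close>.\<close>

lemma up_mult_upmass_le:
  assumes S: "S \<in> ksubsets n k" and T: "T \<in> ksubsets n (k - 1)" "T \<subseteq> S" and U: "U \<subseteq> T"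
  shows "up T S * upmass n k \<mu> (T - U) \<le> 2 ^ k * upmass n k \<mu> (S - U)"
proof (cases "upmass n k \<mu> T = 0")
  case True
  then show ?thesis using S upmass_mu_nonneg by (simp add: up_eq)
next
  case False
  then have pos: "upmass n k \<mu> T > 0" using upmass_mu_nonneg[of T] by simp
  have "card (S - T) = 1"
    using ksubsetsD[OF S] ksubsetsD[OF T(1)] T(2) k_pos by (simp add: card_Diff_subset)
  then obtain x where x: "S - T = {x}" by (auto simp: card_1_singleton_iff)
  have eqs: "insert x T = S" "T - U \<union> U = T" "insert x (T - U) = S - U"
    using x U T(2) by auto
  have fin: "finite T" "finite U" and sub: "T \<subseteq> {1..n}"
    using ksubsetsD[OF T(1)] U finite_subset by auto
  have "upmass n k \<mu> (insert x (T - U \<union> U)) * upmass n k \<mu> (T - U)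
      \<le> 2 ^ card U * upmass n k \<mu> (insert x (T - U)) * upmass n k \<mu> (T - U \<union> U)"
    using x U fin sub by (intro upmass_Un_bound lc nonneg) auto
  then have "\<mu> S * upmass n k \<mu> (T - U) \<le> 2 ^ card U * upmass n k \<mu> (S - U) * upmass n k \<mu> T"
    by (simp only: eqs upmass_ksubset[OF S])
  also have "\<dots> \<le> 2 ^ k * upmass n k \<mu> (S - U) * upmass n k \<mu> T"
  proof -
    have "card U \<le> k"
      using card_mono[OF fin(1) U] ksubsetsD(3)[OF T(1)] by simp
    then show ?thesis
      using upmass_mu_nonneg by (intro mult_right_mono power_increasing) auto
  qed
  finally show ?thesis
    using S T(2) pos by (simp add: up_eq field_simps)
qed

lemma sum_upmass_insert_le: "(\<Sum>e\<in>E. upmass n k \<mu> (insert e A)) \<le> real k * upmass n k \<mu> A"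
  if "E \<subseteq> {1..n}"
proof -
  have "(\<Sum>e\<in>E. upmass n k \<mu> (insert e A)) \<le> (\<Sum>e\<in>{1..n}. upmass n k \<mu> (insert e A))"
    using that upmass_mu_nonneg by (intro sum_mono2) auto
  also have "\<dots> = (\<Sum>S\<in>{S \<in> ksubsets n k. A \<subseteq> S}. \<mu> S * real (card S))"
    using sum_upmass_insert[of n k \<mu> A "\<lambda>_. 1"] by simp
  also have "\<dots> = (\<Sum>S\<in>{S \<in> ksubsets n k. A \<subseteq> S}. \<mu> S * real k)"
    by (intro sum.cong) (auto dest: ksubsetsD(3))
  also have "\<dots> = real k * upmass n k \<mu> A"
    by (simp add: upmass_def mult.commute sum_distrib_left)
  finally show ?thesis .
qed

text \<open>The factor lost per step is crude. It suffices because only the logarithm of the total loss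
  enters the entropy, and the entropy only enters the mixing time through its logarithm.\<close>

lemma track_le:
  assumes "S \<in> ksubsets n k" "U \<subseteq> S0"
  shows "track S0 t U S \<le> growth ^ t * (upmass n k \<mu> (S - U) / M)"
  using assms
proof (induction t arbitrary: U S)
  case 0
  then show ?case using mass_pos upmass_mu_nonneg[of "S - U"] by auto
next
  case (Suc t U S')
  define c where "c = growth ^ t / M"
  have c0: "0 \<le> c" using mass_pos by (simp add: c_def growth_def)
  define B where "B = (\<lambda>T. if T \<subseteq> S' then 2 * c * 2 ^ k * upmass n k \<mu> (S' - U) else 0)"
  have inner: "(\<Sum>e\<in>{1..n} - T. \<Sum>V\<in>{V \<in> Pow S0. V - {e} = U}.
      track S0 t V (insert e T) / real k * up (insert e T - {e}) S') \<le> B T"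
    if T: "T \<in> ksubsets n (k - 1)" for T
  proof (cases "T \<subseteq> S' \<and> U \<subseteq> T")
    case True
    have "(\<Sum>V\<in>{V \<in> Pow S0. V - {e} = U}. track S0 t V (insert e T)) \<le>
        c * (upmass n k \<mu> (insert e (T - U)) + (if e \<in> S0 then upmass n k \<mu> (T - U) else 0))"
      if e: "e \<in> {1..n} - T" for e
    proof -
      have eT: "insert e T \<in> ksubsets n k"
        using insert_in_ksubsets[OF T] e k_pos by simp
      have "e \<notin> U" using e True by auto
      \<comment> \<open>Before the step the record was \<open>U\<close>, or
        \<open>insert e U\<close> if the dropped \<open>e\<close> was a surviving element of
        \<open>S0\<close>.\<close>
      then have V: "{V \<in> Pow S0. V - {e} = U} = (if e \<in> S0 then {U, insert e U} else {U})"
        using Suc.prems(2) by auto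
      have U1: "track S0 t U (insert e T) \<le> c * upmass n k \<mu> (insert e (T - U))"
        using Suc.IH[OF eT Suc.prems(2)] \<open>e \<notin> U\<close> by (simp add: c_def insert_Diff_if)
      have U2: "track S0 t (insert e U) (insert e T) \<le> c * upmass n k \<mu> (T - U)" if "e \<in> S0"
      proof -
        have "insert e T - insert e U = T - U" using e by auto
        then show ?thesis using Suc.IH[OF eT, of "insert e U"] Suc.prems(2) that by (simp add: c_def)
      qed
      show ?thesis
      proof (cases "e \<in> S0")
        case True
        then have "(\<Sum>V\<in>{V \<in> Pow S0. V - {e} = U}. track S0 t V (insert e T)) =
            track S0 t U (insert e T) + track S0 t (insert e U) (insert e T)"
          using V \<open>e \<notin> U\<close> by (simp add: insert_ident insert_absorb) (subst sum.insert, auto)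
        with U1 U2[OF True] True show ?thesis by (simp add: distrib_left)
      next
        case False
        with V U1 show ?thesis by simp
      qed
    qed
    then have "(\<Sum>e\<in>{1..n} - T. \<Sum>V\<in>{V \<in> Pow S0. V - {e} = U}. track S0 t V (insert e T)) \<le>
        (\<Sum>e\<in>{1..n} - T. c * (upmass n k \<mu> (insert e (T - U)) + (if e \<in> S0 then upmass n k \<mu> (T - U) else 0)))"
      by (rule sum_mono)
    also have "\<dots> = c * ((\<Sum>e\<in>{1..n} - T. upmass n k \<mu> (insert e (T - U))) +
        (\<Sum>e\<in>{1..n} - T. if e \<in> S0 then upmass n k \<mu> (T - U) else 0))"
      by (simp only: sum_distrib_left [symmetric] sum.distrib)
    also have "\<dots> \<le> c * (real k * upmass n k \<mu> (T - U) + real k * upmass n k \<mu> (T - U))"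
    proof (intro mult_left_mono add_mono c0 sum_upmass_insert_le)
      have "(\<Sum>e\<in>{1..n} - T. if e \<in> S0 then upmass n k \<mu> (T - U) else 0) =
          (\<Sum>e\<in>{e \<in> {1..n} - T. e \<in> S0}. upmass n k \<mu> (T - U))"
        by (rule sum.inter_filter [symmetric]) simp
      also have "\<dots> \<le> (\<Sum>e\<in>S0. upmass n k \<mu> (T - U))"
        using ksubsetsD(2)[OF S0] upmass_mu_nonneg by (intro sum_mono2) auto
      also have "\<dots> = real k * upmass n k \<mu> (T - U)"
        using ksubsetsD(3)[OF S0] by simp
      finally show "(\<Sum>e\<in>{1..n} - T. if e \<in> S0 then upmass n k \<mu> (T - U) else 0)
          \<le> real k * upmass n k \<mu> (T - U)" .
    qed auto
    finally have "(\<Sum>e\<in>{1..n} - T. \<Sum>V\<in>{V \<in> Pow S0. V - {e} = U}. track S0 t V (insert e T)) *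
         (up T S' / real k) \<le> c * (2 * real k * upmass n k \<mu> (T - U)) * (up T S' / real k)"
      using up_nonneg[OF Suc.prems(1)] by (intro mult_right_mono) auto
    also have "\<dots> = 2 * c * (up T S' * upmass n k \<mu> (T - U))"
      using k_pos by (simp add: mult_ac)
    also have "\<dots> \<le> 2 * c * (2 ^ k * upmass n k \<mu> (S' - U))"
      using True c0 by (intro mult_left_mono up_mult_upmass_le Suc.prems T) auto
    finally have "(\<Sum>e\<in>{1..n} - T. \<Sum>V\<in>{V \<in> Pow S0. V - {e} = U}. track S0 t V (insert e T)) *
         (up T S' / real k) \<le> B T"
      using True by (simp add: B_def mult_ac)
    moreover have "(\<Sum>e\<in>{1..n} - T. \<Sum>V\<in>{V \<in> Pow S0. V - {e} = U}.
        track S0 t V (insert e T) / real k * up (insert e T - {e}) S') =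
      (\<Sum>e\<in>{1..n} - T. \<Sum>V\<in>{V \<in> Pow S0. V - {e} = U}. track S0 t V (insert e T)) * (up T S' / real k)"
      unfolding sum_distrib_right by (intro sum.cong refl) simp
    ultimately show ?thesis by simp
  next
    \<comment> \<open>If \<open>T\<close> is not in \<open>S'\<close>, the up-step cannot reach
      \<open>S'\<close>; if \<open>U\<close> is not in \<open>T\<close>, the old record is not
      contained in the old set.\<close>
    case False
    have "track S0 t V (insert e T) / real k * up (insert e T - {e}) S' = 0"
      if e: "e \<in> {1..n} - T" and V: "V - {e} = U" for e V
    proof (cases "T \<subseteq> S'")
      case True
      with False V have "\<not> V \<subseteq> insert e T" by auto
      moreover have "insert e T \<in> ksubsets n k"
        using insert_in_ksubsets[OF T] e k_pos by simp
      ultimately show ?thesis by (simp add: track_support)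
    next
      case False
      with e show ?thesis by (simp add: up_eq Suc.prems(1))
    qed
    then have "(\<Sum>e\<in>{1..n} - T. \<Sum>V\<in>{V \<in> Pow S0. V - {e} = U}.
        track S0 t V (insert e T) / real k * up (insert e T - {e}) S') = 0"
      by (intro sum.neutral ballI) auto
    then show ?thesis using c0 upmass_mu_nonneg by (simp add: B_def)
  qed
  have "track S0 (Suc t) U S' = (\<Sum>T\<in>ksubsets n (k - 1). \<Sum>e\<in>{1..n} - T.
      \<Sum>V\<in>{V \<in> Pow S0. V - {e} = U}. track S0 t V (insert e T) / real k * up (insert e T - {e}) S')"
    using sum_ksubsets_Suc[of "\<lambda>S e. \<Sum>V\<in>{V \<in> Pow S0. V - {e} = U}.
        track S0 t V S / real k * up (S - {e}) S'" n "k - 1"] k_pos by simp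
  also have "\<dots> \<le> (\<Sum>T\<in>ksubsets n (k - 1). B T)"
    by (intro sum_mono inner)
  also have "\<dots> = real k * (2 * c * 2 ^ k * upmass n k \<mu> (S' - U))"
  proof -
    have "(\<Sum>T\<in>ksubsets n (k - 1). B T) =
        real (card {T \<in> ksubsets n (k - 1). T \<subseteq> S'}) * (2 * c * 2 ^ k * upmass n k \<mu> (S' - U))"
      by (simp add: B_def flip: sum.inter_filter)
    then show ?thesis unfolding card_facets(1)[OF Suc.prems(1)] .
  qed
  also have "\<dots> = growth ^ Suc t * (upmass n k \<mu> (S' - U) / M)"
    by (simp add: c_def growth_def mult_ac)
  finally show ?case .
qed

section \<open>Total variation bound and mixing time\<close>

lemma kernel_power_dominated:
  assumes "0 < \<mu> S0"
  shows "dominated n k (kernel_power (ksubsets n k) P t S0) \<mu>"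
    "(\<Sum>S\<in>ksubsets n k. kernel_power (ksubsets n k) P t S0 S) = 1"
proof -
  have init: "dominated n k (kernel_power (ksubsets n k) P 0 S0) \<mu>"
    using assms nonneg by (auto simp: dominated_def)
  have eq: "kernel_power (ksubsets n k) P t S0 S = (push ^^ t) (kernel_power (ksubsets n k) P 0 S0) S"
    if "S \<in> ksubsets n k" for S
    using kernel_power_add[OF that, of 0 t S0] by simp
  show "dominated n k (kernel_power (ksubsets n k) P t S0) \<mu>"
    using push_iter(1)[OF init, of t] eq by (simp add: dominated_def)
  have "(\<Sum>S\<in>ksubsets n k. kernel_power (ksubsets n k) P t S0 S) =
      (\<Sum>S\<in>ksubsets n k. kernel_power (ksubsets n k) P 0 S0 S)"
    using push_iter(2)[OF init, of t] eq by simp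
  also have "\<dots> = 1" using S0 by (simp add: sum.delta')
  finally show "(\<Sum>S\<in>ksubsets n k. kernel_power (ksubsets n k) P t S0 S) = 1" .
qed

lemma normalized_nonneg: "S \<in> ksubsets n k \<Longrightarrow> 0 \<le> normalized n k \<mu> S"
  using mass_pos nonneg by (simp add: normalized_def flip: upmass_empty)

lemma sum_normalized: "(\<Sum>S\<in>ksubsets n k. normalized n k \<mu> S) = 1"
  using mass_pos by (simp add: normalized_def upmass_empty flip: sum_divide_distrib)

text \<open>The law after \<open>s\<close> steps splits into \<open>a\<close>, where all elements of
  \<open>S0\<close> have been dropped, and the rest \<open>b\<close>. A union bound controls the
  mass of \<open>b\<close>; \<open>a\<close> has bounded density, so its excess is controlled and
  contracts during \<open>t\<close> further steps.\<close>

lemma tv_dist_le: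
  assumes "0 < \<mu> S0"
  shows "tv_dist (ksubsets n k) (kernel_power (ksubsets n k) P (s + t) S0) (normalized n k \<mu>)
      \<le> real k * (1 - 1 / real k) ^ s + sqrt ((1 - 1 / real k) ^ t * (real s * ln growth + 1))"
proof -
  define a b where "a = track S0 s {}" and "b = (\<lambda>S. \<Sum>U\<in>Pow S0 - {{}}. track S0 s U S)"
  define N d where "N = (\<Sum>S\<in>ksubsets n k. a S)" and "d = (\<Sum>S\<in>ksubsets n k. b S)"
  define W where "W = real s * ln growth + 1"
  have fin: "finite S0" using S0 by (rule ksubsetsD)
  have a0: "0 \<le> a S" and b0: "0 \<le> b S" if "S \<in> ksubsets n k" for S
    using track_nonneg[OF that] by (auto simp: a_def b_def intro!: sum_nonneg)
  have ab: "kernel_power (ksubsets n k) P s S0 S = a S + b S" if "S \<in> ksubsets n k" for S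
    unfolding a_def b_def sum_track[OF that, symmetric]
    using fin by (subst sum.remove[of _ "{}"]) auto
  have dom: "dominated n k a \<mu>" "dominated n k b \<mu>"
    using kernel_power_dominated(1)[OF assms, of s] a0 b0
    by (auto simp: dominated_def ab add_nonneg_eq_0_iff)
  have "N + d = 1"
    using kernel_power_dominated(2)[OF assms, of s] by (simp add: N_def d_def ab sum.distrib)
  moreover have "0 \<le> N" "0 \<le> d" using a0 b0 by (auto simp: N_def d_def intro!: sum_nonneg)
  ultimately have N: "0 \<le> N" "N \<le> 1" "0 \<le> d" "d = 1 - N" by auto
  have d_le: "d \<le> real k * (1 - 1 / real k) ^ s"
  proof -
    have "b S \<le> (\<Sum>i\<in>S0. \<Sum>U\<in>Pow S0. (if i \<in> U then 1 else 0) * track S0 s U S)"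
      if S: "S \<in> ksubsets n k" for S
    proof -
      \<comment> \<open>Union bound as an expectation: a nonempty record has at least one
        survivor.\<close>
      have "b S \<le> (\<Sum>U\<in>Pow S0. real (card U) * track S0 s U S)"
      proof -
        have "1 \<le> real (card U)" if "U \<in> Pow S0 - {{}}" for U
        proof -
          have "finite U" using that fin finite_subset by auto
          with that show ?thesis by (simp add: Suc_le_eq card_gt_0_iff)
        qed
        then have "b S \<le> (\<Sum>U\<in>Pow S0 - {{}}. real (card U) * track S0 s U S)"
          unfolding b_def using track_nonneg[OF S]
          by (intro sum_mono) (metis mult_right_mono mult_1)
        also have "\<dots> \<le> (\<Sum>U\<in>Pow S0. real (card U) * track S0 s U S)"
          using fin track_nonneg[OF S] by (intro sum_mono2) auto
        finally show ?thesis .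
      qed
      also have "\<dots> = (\<Sum>U\<in>Pow S0. \<Sum>i\<in>S0. (if i \<in> U then 1 else 0) * track S0 s U S)"
      proof (intro sum.cong refl)
        fix U assume "U \<in> Pow S0"
        then have "{i \<in> S0. i \<in> U} = U" by auto
        then show "real (card U) * track S0 s U S = (\<Sum>i\<in>S0. (if i \<in> U then 1 else 0) * track S0 s U S)"
          using fin by (simp add: sum.inter_filter [symmetric] flip: sum_distrib_right)
      qed
      also have "\<dots> = (\<Sum>i\<in>S0. \<Sum>U\<in>Pow S0. (if i \<in> U then 1 else 0) * track S0 s U S)"
        by (rule sum.swap)
      finally show ?thesis .
    qed
    then have "d \<le> (\<Sum>S\<in>ksubsets n k. \<Sum>i\<in>S0. \<Sum>U\<in>Pow S0. (if i \<in> U then 1 else 0) * track S0 s U S)"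
      unfolding d_def by (rule sum_mono)
    also have "\<dots> = (\<Sum>i\<in>S0. \<Sum>S\<in>ksubsets n k. \<Sum>U\<in>Pow S0. (if i \<in> U then 1 else 0) * track S0 s U S)"
      by (rule sum.swap)
    also have "\<dots> \<le> (\<Sum>i\<in>S0. (1 - 1 / real k) ^ s)"
      by (intro sum_mono track_survival)
    finally show ?thesis using ksubsetsD(3)[OF S0] by simp
  qed
  have growth: "1 \<le> growth"
  proof -
    have "1 * (1 * 1) \<le> (2 :: real) * (real k * 2 ^ k)"
      using k_pos by (intro mult_mono) auto
    then show ?thesis by (simp add: growth_def)
  qed
  then have W: "0 \<le> W" by (simp add: W_def)
  have excess_a: "excess a \<le> W"
  proof -
    have "a S * ln (a S / \<mu> S) \<le> a S * (real s * ln growth - ln M)" if S: "S \<in> ksubsets n k" for S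
    proof (cases "a S = 0")
      case False
      then have pos: "a S > 0" "\<mu> S > 0" using dominatedD[OF dom(1) S] by (auto simp: order_less_le)
      \<comment> \<open>For the empty record, \<open>track_le\<close> bounds the density relative to
        the stationary distribution by \<open>growth ^ s\<close>.\<close>
      have "a S \<le> growth ^ s * (\<mu> S / M)"
        using track_le[OF S, of "{}" s] by (simp add: a_def upmass_ksubset[OF S])
      then have "a S / \<mu> S \<le> growth ^ s / M"
        using pos by (simp add: field_simps)
      then have "ln (a S / \<mu> S) \<le> ln (growth ^ s / M)"
        using pos by (intro ln_mono) auto
      also have "\<dots> = real s * ln growth - ln M"
        using growth mass_pos by (simp add: ln_div ln_realpow)
      finally show ?thesis using pos by (intro mult_left_mono) auto
    qed simp
    then have "entropy n k a \<mu> k \<le> (\<Sum>S\<in>ksubsets n k. a S * (real s * ln growth - ln M))"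
      unfolding entropy_top by (rule sum_mono)
    also have "\<dots> = N * (real s * ln growth) - N * ln M"
      by (simp only: N_def right_diff_distrib sum_subtractf sum_distrib_right)
    finally have "entropy n k a \<mu> k \<le> N * (real s * ln growth) - N * ln M" .
    moreover have "entropy n k a \<mu> 0 = N * ln N - N * ln M"
      using mass_pos N by (cases "N = 0") (simp_all add: entropy_0 upmass_empty[of n k a] ln_div right_diff_distrib flip: N_def)
    \<comment> \<open>Source of the \<open>+ 1\<close> in \<open>W\<close>: the mass
      \<open>N\<close> of \<open>a\<close> may be less than 1.\<close>
    moreover have "N - 1 \<le> N * ln N" using xlnx_ge_tangent[OF N(1), of 1] by simp
    moreover have "N * (real s * ln growth) \<le> real s * ln growth"
      using N growth by (intro mult_left_le_one_le) auto
    ultimately show ?thesis using N(1) unfolding excess_def W_def by linarith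
  qed
  have l1: "(\<Sum>S\<in>ksubsets n k. \<bar>(push ^^ t) a S - N * normalized n k \<mu> S\<bar>)
      \<le> 2 * sqrt ((1 - 1 / real k) ^ t * W)"
  proof -
    have rho: "0 \<le> (1 - 1 / real k) ^ t" using k_pos by simp
    have "(\<Sum>S\<in>ksubsets n k. \<bar>(push ^^ t) a S - N * normalized n k \<mu> S\<bar>)\<^sup>2
        \<le> 4 * N * excess ((push ^^ t) a)"
      by (rule l1_dist_le) (use push_iter[OF dom(1)] in \<open>simp_all add: N_def\<close>)
    also have "\<dots> \<le> 4 * N * ((1 - 1 / real k) ^ t * excess a)"
      using N by (intro mult_left_mono excess_iter_le lc dom) auto
    also have "\<dots> \<le> 4 * N * ((1 - 1 / real k) ^ t * W)"
      using N rho excess_a by (intro mult_left_mono) auto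
    also have "\<dots> \<le> 4 * ((1 - 1 / real k) ^ t * W)"
      using N rho W by (intro mult_right_mono) auto
    also have "\<dots> = (2 * sqrt ((1 - 1 / real k) ^ t * W))\<^sup>2"
      using rho W by (simp add: power_mult_distrib)
    finally show ?thesis
      by (rule power2_le_imp_le) (use rho W in simp)
  qed
  \<comment> \<open>As \<open>N + d = 1\<close>, the stationary distribution is split like the law.
    The part from \<open>b\<close> is bounded trivially and costs \<open>2 * d\<close> in the
    sum.\<close>
  have pointwise: "\<bar>kernel_power (ksubsets n k) P (s + t) S0 S - normalized n k \<mu> S\<bar>
      \<le> \<bar>(push ^^ t) a S - N * normalized n k \<mu> S\<bar> + ((push ^^ t) b S + d * normalized n k \<mu> S)"
    if S: "S \<in> ksubsets n k" for S
  proof -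
    have "kernel_power (ksubsets n k) P (s + t) S0 S = (push ^^ t) (\<lambda>S. a S + b S) S"
      unfolding kernel_power_add[OF S] by (rule push_iter_cong[OF ab S])
    also have "\<dots> = (push ^^ t) a S + (push ^^ t) b S"
      by (simp add: push_iter_add)
    finally have "kernel_power (ksubsets n k) P (s + t) S0 S - normalized n k \<mu> S =
        ((push ^^ t) a S - N * normalized n k \<mu> S) + ((push ^^ t) b S - d * normalized n k \<mu> S)"
      unfolding N(4) by (simp add: algebra_simps)
    moreover have "0 \<le> (push ^^ t) b S"
      using dominatedD(2)[OF push_iter(1)[OF dom(2)] S] .
    moreover have "0 \<le> d * normalized n k \<mu> S"
      using N normalized_nonneg[OF S] by simp
    ultimately show ?thesis by linarith
  qed
  have "(\<Sum>S\<in>ksubsets n k. \<bar>kernel_power (ksubsets n k) P (s + t) S0 S - normalized n k \<mu> S\<bar>)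
      \<le> (\<Sum>S\<in>ksubsets n k. \<bar>(push ^^ t) a S - N * normalized n k \<mu> S\<bar> +
            ((push ^^ t) b S + d * normalized n k \<mu> S))"
    by (intro sum_mono pointwise)
  also have "\<dots> = (\<Sum>S\<in>ksubsets n k. \<bar>(push ^^ t) a S - N * normalized n k \<mu> S\<bar>) + (d + d)"
    by (simp add: sum.distrib push_iter(2)[OF dom(2)] sum_normalized flip: sum_distrib_left d_def)
  finally show ?thesis
    using l1 d_le unfolding tv_dist_def W_def by linarith
qed

lemma mixing_time_le:
  assumes "0 < \<mu> S0" "2 \<le> k" "0 < \<epsilon>" "\<epsilon> < 1"
  shows "ereal_of_enat (mixing_time (ksubsets n k) P (normalized n k \<mu>) S0 \<epsilon>)
    \<le> ereal (22 * real k * ln (real k / \<epsilon>))"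
proof -
  define x where "x = real k / \<epsilon>"
  have kx: "real k \<le> x"
    using assms by (simp add: x_def field_simps mult_left_le)
  then have x2: "2 \<le> x" using assms by linarith
  have lnx: "1 / 2 \<le> ln x"
    using ln2_ge_two_thirds ln_mono[of 2 x] x2 by linarith
  \<comment> \<open>Both phases last \<open>s\<close> steps. The constant 10 brings the contraction
    factor down to \<open>1 / x ^ 10\<close>, which absorbs the factor \<open>k\<close> in the first
    term and an entropy of at most \<open>x ^ 8\<close> under the root in the second.\<close>
  define s where "s = nat \<lceil>10 * real k * ln x\<rceil>"
  have "0 \<le> 10 * real k * ln x" using lnx by simp
  then have s: "10 * real k * ln x \<le> real s" "real s \<le> 10 * real k * ln x + 1"
    unfolding s_def by linarith+
  have rho: "(1 - 1 / real k) ^ s \<le> 1 / x ^ 10"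
  proof -
    have "(1 - 1 / real k) ^ s \<le> exp (- (1 / real k)) ^ s"
      using assms(2) exp_ge_add_one_self[of "- (1 / real k)"] by (intro power_mono) auto
    also have "\<dots> = exp (- (real s / real k))"
      by (simp flip: exp_of_nat_mult)
    also have "\<dots> \<le> exp (- (10 * ln x))"
      using s(1) assms(2) by (simp add: field_simps)
    also have "\<dots> = 1 / x ^ 10"
    proof -
      have "10 * ln x = ln (x ^ 10)" using x2 by (simp add: ln_realpow)
      then show ?thesis using x2 by (simp add: exp_minus field_simps)
    qed
    finally show ?thesis .
  qed
  have rho0: "0 \<le> (1 - 1 / real k) ^ s" using assms(2) by simp
  have ln_growth: "0 \<le> ln growth" "ln growth \<le> 3 * real k"
  proof -
    have "real k \<le> 2 ^ k" using of_nat_less_two_power[of k, where 'a = real] by simp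
    then have "growth \<le> 2 * 2 ^ k * 2 ^ k" unfolding growth_def by (intro mult_right_mono) auto
    then have "growth \<le> 2 ^ (1 + k + k)" by (simp add: power_add)
    moreover have "1 * (1 * 1) \<le> (2 :: real) * (real k * 2 ^ k)"
      using assms(2) by (intro mult_mono) auto
    then have g1: "1 \<le> growth" by (simp add: growth_def)
    ultimately have "ln growth \<le> ln (2 ^ (1 + k + k))" by (intro ln_mono) auto
    also have "\<dots> = real (1 + k + k) * ln 2" by (rule ln_realpow)
    also have "\<dots> \<le> real (1 + k + k) * 1"
      using ln_le_minus_one[of "2::real"] by (intro mult_left_mono) auto
    finally show "ln growth \<le> 3 * real k" using assms(2) by simp
    show "0 \<le> ln growth" using g1 by simp
  qed
  have first: "real k * (1 - 1 / real k) ^ s \<le> \<epsilon> / 2"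
  proof -
    have "2 ^ 9 \<le> x ^ 9" using x2 by (intro power_mono) auto
    then have "2 * x \<le> x ^ 9 * x" using x2 by (intro mult_right_mono) auto
    also have "\<dots> = x ^ 10" by (simp flip: power_Suc2)
    finally have "1 / x ^ 10 \<le> 1 / (2 * x)" using x2 by (intro divide_left_mono) auto
    with rho have "real k * (1 - 1 / real k) ^ s \<le> real k * (1 / (2 * x))"
      by (intro mult_left_mono) auto
    also have "\<dots> = \<epsilon> / 2" using assms by (simp add: x_def)
    finally show ?thesis .
  qed
  have second: "sqrt ((1 - 1 / real k) ^ s * (real s * ln growth + 1)) \<le> \<epsilon> / 2"
  proof -
    have "10 * real k * ln x \<le> 10 * real k * (x - 1)"
      using x2 by (intro mult_left_mono ln_le_minus_one) auto
    then have "real s \<le> 10 * real k * x"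
      using s(2) assms(2) by (simp add: algebra_simps)
    also have "\<dots> \<le> 10 * x * x" using kx x2 by (intro mult_right_mono) auto
    finally have "real s * ln growth \<le> (10 * x * x) * (3 * x)"
      using ln_growth kx x2 by (intro mult_mono) auto
    moreover have "1 \<le> x ^ 3" using x2 by simp
    ultimately have "real s * ln growth + 1 \<le> 31 * x ^ 3"
      by (simp add: power3_eq_cube)
    also have "\<dots> \<le> x ^ 5 * x ^ 3"
      using power_mono[of 2 x 5] x2 by (intro mult_right_mono) auto
    also have "\<dots> = x ^ 8" by (simp flip: power_add)
    finally have "(1 - 1 / real k) ^ s * (real s * ln growth + 1) \<le> 1 / x ^ 10 * x ^ 8"
      using rho rho0 x2 ln_growth by (intro mult_mono) auto
    also have "\<dots> = (1 / x)\<^sup>2"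
      using x2 by (simp add: power_divide divide_simps flip: power_add)
    finally have "sqrt ((1 - 1 / real k) ^ s * (real s * ln growth + 1)) \<le> 1 / x"
      using x2 by (intro real_le_lsqrt) auto
    \<comment> \<open>Here \<open>1 / x\<close> is \<open>\<epsilon> / k\<close>, so
      \<open>k \<ge> 2\<close> is what makes this hold.\<close>
    also have "\<dots> \<le> \<epsilon> / 2"
      using assms by (simp add: x_def field_simps)
    finally show ?thesis .
  qed
  have "tv_dist (ksubsets n k) (kernel_power (ksubsets n k) P (s + s) S0) (normalized n k \<mu>) \<le> \<epsilon>"
    using tv_dist_le[OF assms(1), of s s] first second by linarith
  then have "mixing_time (ksubsets n k) P (normalized n k \<mu>) S0 \<epsilon> \<le> enat (s + s)"
    unfolding mixing_time_def by (intro INF_lower) simp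
  then have "ereal_of_enat (mixing_time (ksubsets n k) P (normalized n k \<mu>) S0 \<epsilon>) \<le> ereal (real (s + s))"
    by (metis ereal_of_enat_le_iff ereal_of_enat_simps(1))
  \<comment> \<open>Rounding up twice costs at most 2 steps; raising 20 to 22 absorbs them because
    \<open>k * ln x \<ge> 1\<close>.\<close>
  also have "real (s + s) \<le> 22 * real k * ln x"
  proof -
    have "2 * (1 / 2) \<le> real k * ln x" using assms(2) lnx by (intro mult_mono) auto
    then show ?thesis using s(2) by simp
  qed
  finally show ?thesis by (simp add: x_def)
qed

text \<open>For \<open>k = 1\<close> the contraction factor \<open>1 - 1 / k\<close> vanishes.\<close>

lemma mixing_time_le_1:
  assumes pos: "0 < \<mu> S0" and k: "k = 1" and eps: "0 < \<epsilon>"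
  shows "mixing_time (ksubsets n k) P (normalized n k \<mu>) S0 \<epsilon> \<le> enat 1"
proof -
  let ?K = "kernel_power (ksubsets n k) P"
  have "excess (push (?K 0 S0)) \<le> (1 - 1 / real k) * excess (?K 0 S0)"
    by (intro excess_push_le lc kernel_power_dominated pos)
  moreover have "?K 1 S0 = push (?K 0 S0)"
    by (simp add: push_def fun_eq_iff)
  ultimately have "excess (?K 1 S0) \<le> 0" using k by simp
  moreover have "(\<Sum>S\<in>ksubsets n k. \<bar>?K 1 S0 S - 1 * normalized n k \<mu> S\<bar>)\<^sup>2 \<le> 4 * 1 * excess (?K 1 S0)"
    by (intro l1_dist_le kernel_power_dominated kernel_power_dominated(2)[symmetric] pos)
  ultimately have "(\<Sum>S\<in>ksubsets n k. \<bar>?K 1 S0 S - 1 * normalized n k \<mu> S\<bar>)\<^sup>2 \<le> 0"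
    by linarith
  then have "tv_dist (ksubsets n k) (?K 1 S0) (normalized n k \<mu>) = 0"
    by (simp add: tv_dist_def)
  then show ?thesis
    using eps unfolding mixing_time_def by (intro INF_lower) simp
qed

end

end

end

theorem theorem1p1:
  shows "\<exists>C::real. C > 0 \<and>
    (\<forall>(n::nat) (k::nat) (\<mu> :: nat set \<Rightarrow> real) (S\<^sub>0 :: nat set) (\<epsilon>::real).
       1 \<le> k \<longrightarrow> k \<le> n \<longrightarrow>
       (\<forall>S\<in>ksubsets n k. 0 \<le> \<mu> S) \<longrightarrow>
       (\<exists>S\<in>ksubsets n k. \<mu> S \<noteq> 0) \<longrightarrow>
       log_concave n (gen_poly n k \<mu>) \<longrightarrow>
       S\<^sub>0 \<in> ksubsets n k \<longrightarrow> 0 < \<mu> S\<^sub>0 \<longrightarrow>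
       0 < \<epsilon> \<longrightarrow> \<epsilon> < 1 \<longrightarrow>
       ereal_of_enat
         (mixing_time (ksubsets n k) (down_up_walk n k \<mu>) (normalized n k \<mu>) S\<^sub>0 \<epsilon>)
       \<le> ereal (if k = 1 then real_of_int \<lceil>C * real k * ln (real k / \<epsilon>)\<rceil>
                 else C * real k * ln (real k / \<epsilon>)))"
proof (intro exI[of _ 22] conjI allI impI)
  fix n k :: nat and \<mu> :: "nat set \<Rightarrow> real" and S0 :: "nat set" and \<epsilon> :: real
  assume k: "1 \<le> k" and nn: "\<forall>S\<in>ksubsets n k. 0 \<le> \<mu> S"
    and lc: "log_concave n (gen_poly n k \<mu>)" and S0: "S0 \<in> ksubsets n k" "0 < \<mu> S0"
    and eps: "0 < \<epsilon>" "\<epsilon> < 1"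
  have "0 < upmass n k \<mu> {}"
    unfolding upmass_empty using nn S0 by (intro sum_pos2[of _ S0]) auto
  then interpret weighted_ksubsets n k \<mu>
    using k nn by unfold_locales auto
  let ?m = "mixing_time (ksubsets n k) (down_up_walk n k \<mu>) (normalized n k \<mu>) S0 \<epsilon>"
  show "ereal_of_enat ?m \<le> ereal (if k = 1 then real_of_int \<lceil>22 * real k * ln (real k / \<epsilon>)\<rceil>
                 else 22 * real k * ln (real k / \<epsilon>))"
  proof (cases "k = 1")
    case True
    have "ereal_of_enat ?m \<le> ereal_of_enat (enat 1)"
      unfolding ereal_of_enat_le_iff by (rule mixing_time_le_1 [OF S0(1) lc S0(2) True eps(1)])
    also have "\<dots> = ereal 1" by simp
    \<comment> \<open>The logarithm is positive because \<open>\<epsilon> < 1\<close>, so the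
      ceiling is at least 1 and covers the single step needed.\<close>
    also have "\<dots> \<le> ereal (real_of_int \<lceil>22 * real k * ln (real k / \<epsilon>)\<rceil>)"
    proof -
      have "0 < 22 * real k * ln (real k / \<epsilon>)"
        using True eps by simp
      then have "1 \<le> \<lceil>22 * real k * ln (real k / \<epsilon>)\<rceil>" by linarith
      then show ?thesis by simp
    qed
    finally show ?thesis using True by simp
  next
    case False
    then show ?thesis using mixing_time_le[OF S0(1) lc S0(2) _ eps] k by simp
  qed
qed simp

end
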